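(* For the functions $y_{\alpha_1},y_{\alpha_2},y_\lambda,y_{\beta_1},y_{\beta_2},y_x$ defined in the context, the linear relationships $$\begin{aligned}y_{\beta_1}(x)&=J_{1,1}(x)(y_{\alpha_1}(x)-y_{\alpha_2}(x))+J_{1,3}(x)y_x(x)\\&=J_{2,1}(x)(y_{\alpha_1}(x)-y_{\alpha_2}(x))+J_{2,3}(x)y_{\beta_2}(x)\\&=J_{3,1}(x)(y_{\alpha_2}(x)-y_\lambda(x))+J_{3,3}(x)y_x(x)\\&=J_{4,1}(x)(y_{\alpha_2}(x)-y_\lambda(x))+J_{4,3}(x)y_{\beta_2}(x)\\&=J_{5,1}(x)(y_{\alpha_1}(x)-y_\lambda(x))+J_{5,3}(x)y_x(x)\\&=J_{6,1}(x)(y_{\alpha_1}(x)-y_\lambda(x))+J_{6,3}(x)y_{\beta_2}(x),\end{aligned}$$ $$\begin{aligned}y_{\beta_2}(x)&=K_{1,1}(x)(y_{\alpha_1}(x)-y_{\alpha_2}(x))+K_{1,3}(x)y_x(x)\\&=K_{3,1}(x)(y_{\alpha_2}(x)-y_\lambda(x))+K_{3,3}(x)y_x(x)\\&=K_{5,1}(x)(y_{\alpha_1}(x)-y_\lambda(x))+K_{5,3}(x)y_x(x)\end{aligned}$$ hold, where the coefficients are the following functions, all of which are pseudo-constants (i.e. invariant under $x\mapsto qx$): $$J_{1,1}(x)=-\beta_1^{\lambda-\mu'}x^\lambda\frac{\vartheta_q(\beta_1x)\vartheta_q(\alpha_2/\beta_2)\vartheta_q(\beta_2/\alpha_1)}{\vartheta_q(q^{-\lambda}\beta_1x)\vartheta_q(\alpha_1\alpha_2/(\beta_1\beta_2))\vartheta_q(\alpha_2/\alpha_1)},$$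 $$J_{1,3}(x)=-q^{-\lambda+\mu'}\beta_1^{\lambda-\mu'}x^{\lambda-\mu'}\frac{\vartheta_q(\beta_1x)\vartheta_q(q^\lambda)\vartheta_q(\alpha_1\alpha_2x/(q\beta_2))}{\vartheta_q(q^{-\lambda}\beta_1x)\vartheta_q(\beta_1x/q)\vartheta_q(\alpha_1\alpha_2/(\beta_1\beta_2))},$$ $$J_{2,1}(x)=-\beta_1^{\lambda-\mu'}x^\lambda\frac{\vartheta_q(\alpha_1x)\vartheta_q(\alpha_2x/q)\vartheta_q(\beta_2/\beta_1)}{\vartheta_q(q^{-\lambda}\beta_1x)\vartheta_q(\alpha_1\alpha_2x/(q\beta_1))\vartheta_q(\alpha_2/\alpha_1)},$$ $$J_{2,3}(x)=-\left(\frac{\beta_1}{\beta_2}\right)^{\lambda-\mu'}\frac{\vartheta_q(\beta_2/\beta_1)\vartheta_q(\alpha_1\alpha_2x/(q\beta_2))\vartheta_q(q^{-\lambda}\beta_2x)}{\vartheta_q(q^{-\lambda}\beta_1x)\vartheta_q(\beta_1/\beta_2)\vartheta_q(\alpha_1\alpha_2x/(q\beta_1))},$$ $$J_{3,1}(x)=-\frac{\alpha_2}{q\alpha_1}\beta_1^{\lambda-\mu'}x^\lambda\frac{\vartheta_q(\beta_1x)\vartheta_q(\alpha_2/\beta_2)\vartheta_q(q^{-\lambda}\beta_2x)}{\vartheta_q(\beta_1/\alpha_1)\vartheta_q(q^{-\lambda+1}\beta_1\beta_2x/\alpha_2)\vartheta_q(q^{-\lambda-1}\alpha_2x)},$$ $$J_{3,3}(x)=-\left(\frac{\beta_1}{q}\right)^{\lambda-\mu'}x^{\lambda-\mu'}\frac{\vartheta_q(\beta_1x)\vartheta_q(\alpha_1x)\vartheta_q(q^{\lambda-1}\alpha_2/\beta_2)}{\vartheta_q(\beta_1/\alpha_1)\vartheta_q(\beta_1x/q)\vartheta_q(q^{-\lambda+1}\beta_1\beta_2x/\alpha_2)},$$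 $$J_{4,1}(x)=-\frac{\alpha_2}{q\alpha_1}\beta_1^{\lambda-\mu'}x^\lambda\frac{\vartheta_q(q^\lambda)\vartheta_q(\alpha_2x/q)\vartheta_q(\beta_2/\beta_1)}{\vartheta_q(\beta_1/\alpha_1)\vartheta_q(q^{\lambda-1}\alpha_2/\beta_1)\vartheta_q(q^{-\lambda-1}\alpha_2x)},$$ $$J_{4,3}(x)=-\left(\frac{\beta_1}{\beta_2}\right)^{\lambda-\mu'}\frac{\vartheta_q(\beta_2/\beta_1)\vartheta_q(q^{\lambda-1}\alpha_2/\beta_2)\vartheta_q(\beta_2/\alpha_1)}{\vartheta_q(\beta_1/\alpha_1)\vartheta_q(\beta_1/\beta_2)\vartheta_q(q^{\lambda-1}\alpha_2/\beta_1)},$$ $$J_{5,1}(x)=-\beta_1^{\lambda-\mu'}x^\lambda\frac{\vartheta_q(\beta_1x)\vartheta_q(q^{-\lambda}\beta_2x)\vartheta_q(\beta_2/\alpha_1)}{\vartheta_q(\alpha_2/\beta_1)\vartheta_q(q^{-\lambda}\beta_1\beta_2x/\alpha_1)\vartheta_q(q^{-\lambda}\alpha_1x)},$$ $$J_{5,3}(x)=-\left(\frac q{\beta_1}\right)^{-\lambda+\mu'}x^{\lambda-\mu'}\frac{\vartheta_q(\beta_1x)\vartheta_q(\alpha_2x/q)\vartheta_q(q^\lambda\alpha_1/\beta_2)}{\vartheta_q(\beta_1x/q)\vartheta_q(\alpha_2/\beta_1)\vartheta_q(q^{-\lambda}\beta_1\beta_2x/\alpha_1)},$$ $$J_{6,1}(x)=-\beta_1^{\lambda-\mu'}x^\lambda\frac{\vartheta_q(q^\lambda)\vartheta_q(\alpha_1x)\vartheta_q(\beta_2/\beta_1)}{\vartheta_q(\alpha_2/\beta_1)\vartheta_q(q^\lambda\alpha_1/\beta_1)\vartheta_q(q^{-\lambda}\alpha_1x)},$$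 $$J_{6,3}(x)=-\left(\frac{\beta_1}{\beta_2}\right)^{\lambda-\mu'}\frac{\vartheta_q(\beta_2/\beta_1)\vartheta_q(\alpha_2/\beta_2)\vartheta_q(q^\lambda\alpha_1/\beta_2)}{\vartheta_q(\beta_1/\beta_2)\vartheta_q(\alpha_2/\beta_1)\vartheta_q(q^\lambda\alpha_1/\beta_1)},$$ and, for $m\in\{1,3,5\}$ and $n\in\{1,3\}$, $K_{m,n}(x)$ is obtained from $J_{m,n}(x)$ by interchanging $\beta_1$ and $\beta_2$.
   Context: $q$ is a complex number with $0<|q|<1$. Notation: $(a;q)_n=\prod_{j=0}^{n-1}(1-q^ja)$, $(a;q)_\infty=\prod_{j=0}^\infty(1-q^ja)$, $(a_1,\dots,a_N;q)_n=\prod_i(a_i;q)_n$ (also for $n=\infty$), $\vartheta_q(t)=(t,q/t,q;q)_\infty$, and $${}_3\phi_2\left(\begin{array}{c}a_1,a_2,a_3\\ b_1,b_2\end{array};q,z\right)=\sum_{n=0}^\infty\frac{(a_1,a_2,a_3;q)_n}{(q;q)_n(b_1,b_2;q)_n}z^n.$$ $\alpha_1,\alpha_2,\beta_1,\beta_2\in\mathbb{C}\setminus\{0\}$, $\lambda,\mu'\in\mathbb{C}$ with $q^{\mu'}\alpha_1\alpha_2/(\beta_1\beta_2)=1$ and $|q^\lambda\alpha_1\alpha_2/(\beta_1\beta_2)|<1$. Parameters and $x$ are generic, so that no denominator vanishes. Values of $\log q,\log\beta_1,\log\beta_2,\log x$ are fixed with $\log(qx)=\log q+\log x$; $t^s=\exp(s\log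 t)$, and $(a/b)^s=a^s/b^s$ for $a,b\in\{q,\beta_1,\beta_2\}$. A pseudo-constant is a function $S(x)$ with $S(qx)=S(x)$. $$y_{\alpha_1}(x)=(q-1)\frac{(q^{\lambda+1}/(\alpha_1x),q,\alpha_2/\alpha_1;q)_\infty}{(q/(\alpha_1x),\beta_1/\alpha_1,\beta_2/\alpha_1;q)_\infty}\,{}_3\phi_2\left(\begin{array}{c}q/(\alpha_1x),\beta_1/\alpha_1,\beta_2/\alpha_1\\ q^{\lambda+1}/(\alpha_1x),\alpha_2/\alpha_1\end{array};q,q\right),$$ $$y_{\alpha_2}(x)=(q-1)q\frac{\alpha_1}{\alpha_2}\frac{(q^{\lambda+2}/(\alpha_2x),q^2\alpha_1/\alpha_2,q;q)_\infty}{(q^2/(\alpha_2x),q\beta_1/\alpha_2,q\beta_2/\alpha_2;q)_\infty}\,{}_3\phi_2\left(\begin{array}{c}q^2/(\alpha_2x),q\beta_1/\alpha_2,q\beta_2/\alpha_2\\ q^{\lambda+2}/(\alpha_2x),q^2\alpha_1/\alpha_2\end{array};q,q\right),$$ $$y_\lambda(x)=(q-1)q^{-\lambda}\alpha_1x\frac{(q,q^{-\lambda+1}\alpha_1x,q^{-\lambda}\alpha_2x;q)_\infty}{(q^{-\lambda+1},q^{-\lambda}\beta_1x,q^{-\lambda}\beta_2x;q)_\infty}\,{}_3\phi_2\left(\begin{array}{c}q^{-\lambda+1},q^{-\lambda}\beta_1x,q^{-\lambda}\beta_2x\\ q^{-\lambda+1}\alpha_1x,q^{-\lambda}\alpha_2x\end{array};q,q\right),$$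 $$y_{\beta_1}(x)=(1-q)\beta_1^{\lambda-\mu'}x^\lambda\frac{(\beta_1x,q,q\beta_1/\beta_2;q)_\infty}{(q^{-\lambda}\beta_1x,\beta_1/\alpha_1,q\beta_1/\alpha_2;q)_\infty}\,{}_3\phi_2\left(\begin{array}{c}q^{-\lambda}\beta_1x,\beta_1/\alpha_1,q\beta_1/\alpha_2\\ \beta_1x,q\beta_1/\beta_2\end{array};q,q^\lambda\frac{\alpha_1\alpha_2}{\beta_1\beta_2}\right),$$ $$y_{\beta_2}(x)=(1-q)\beta_2^{\lambda-\mu'}x^\lambda\frac{(\beta_2x,q,q\beta_2/\beta_1;q)_\infty}{(q^{-\lambda}\beta_2x,\beta_2/\alpha_1,q\beta_2/\alpha_2;q)_\infty}\,{}_3\phi_2\left(\begin{array}{c}q^{-\lambda}\beta_2x,\beta_2/\alpha_1,q\beta_2/\alpha_2\\ \beta_2x,q\beta_2/\beta_1\end{array};q,q^\lambda\frac{\alpha_1\alpha_2}{\beta_1\beta_2}\right),$$ $$y_x(x)=(1-q)q^{\lambda-\mu'}x^{\mu'}\frac{(q^2/(\beta_1x),q^2/(\beta_2x),q;q)_\infty}{(q/(\alpha_1x),q^2/(\alpha_2x),q^{-\lambda+1};q)_\infty}\,{}_3\phi_2\left(\begin{array}{c}q^{-\lambda+1},q/(\alpha_1x),q^2/(\alpha_2x)\\ q^2/(\beta_1x),q^2/(\beta_2x)\end{array};q,q^\lambda\frac{\alpha_1\alpha_2}{\beta_1\beta_2}\right).$$ *)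

theory Defs
  imports "HOL-Analysis.Analysis"
begin

definition qpoch :: "complex \<Rightarrow> complex list \<Rightarrow> nat \<Rightarrow> complex" where
  "qpoch q as n = (\<Prod>a\<leftarrow>as. \<Prod>j<n. 1 - q ^ j * a)"

definition qpoch_inf :: "complex \<Rightarrow> complex list \<Rightarrow> complex" where
  "qpoch_inf q as = (\<Prod>a\<leftarrow>as. prodinf (\<lambda>j. 1 - q ^ j * a))"

definition theta :: "complex \<Rightarrow> complex \<Rightarrow> complex" where
  "theta q t = qpoch_inf q [t, q / t, q]"

definition phi32 ::
  "complex \<Rightarrow> complex \<Rightarrow> complex \<Rightarrow> complex \<Rightarrow> complex \<Rightarrow> complex \<Rightarrow> complex \<Rightarrow> complex" where
  "phi32 q a1 a2 a3 b1 b2 z =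
     (\<Sum>n. qpoch q [a1, a2, a3] n / (qpoch q [q] n * qpoch q [b1, b2] n) * z ^ n)"

text \<open>
  The parameters, in this order: \<open>q\<close> and the chosen value \<open>lq\<close> of its logarithm,
  \<open>\<alpha>1, \<alpha>2, \<beta>1, \<beta>2\<close>, the chosen values \<open>l1, l2\<close> of the logarithms of
  \<open>\<beta>1, \<beta>2\<close>, the exponents \<open>lam\<close> and \<open>mu\<close> (the paper's \<open>\<mu>'\<close>), and a function
  \<open>lx\<close> that gives the value of \<open>log x\<close> at each \<open>x\<close>. A power \<open>t\<^sup>s\<close> with a complex exponent
  is written out as \<open>exp (s * log t)\<close> with these logarithms (neither \<open>ln\<close> nor \<open>powr\<close> is
  used, since they would force the principal branch).
\<close>
datatype params = Params complex complex complex complex complex complex complex complex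
  complex complex "complex \<Rightarrow> complex"

fun swap_beta :: "params \<Rightarrow> params" where
  "swap_beta (Params q lq \<alpha>1 \<alpha>2 \<beta>1 \<beta>2 l1 l2 lam mu lx) = Params q lq \<alpha>1 \<alpha>2 \<beta>2 \<beta>1 l2 l1 lam mu lx"

fun y_alpha1 :: "params \<Rightarrow> complex \<Rightarrow> complex" where
  "y_alpha1 (Params q lq \<alpha>1 \<alpha>2 \<beta>1 \<beta>2 l1 l2 lam mu lx) x =
     (q - 1)
     * (qpoch_inf q [exp ((lam + 1) * lq) / (\<alpha>1 * x), q, \<alpha>2 / \<alpha>1]
        / qpoch_inf q [q / (\<alpha>1 * x), \<beta>1 / \<alpha>1, \<beta>2 / \<alpha>1])
     * phi32 q (q / (\<alpha>1 * x)) (\<beta>1 / \<alpha>1) (\<beta>2 / \<alpha>1)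
         (exp ((lam + 1) * lq) / (\<alpha>1 * x)) (\<alpha>2 / \<alpha>1) q"

fun y_alpha2 :: "params \<Rightarrow> complex \<Rightarrow> complex" where
  "y_alpha2 (Params q lq \<alpha>1 \<alpha>2 \<beta>1 \<beta>2 l1 l2 lam mu lx) x =
     (q - 1) * q * (\<alpha>1 / \<alpha>2)
     * (qpoch_inf q [exp ((lam + 2) * lq) / (\<alpha>2 * x), q^2 * \<alpha>1 / \<alpha>2, q]
        / qpoch_inf q [q^2 / (\<alpha>2 * x), q * \<beta>1 / \<alpha>2, q * \<beta>2 / \<alpha>2])
     * phi32 q (q^2 / (\<alpha>2 * x)) (q * \<beta>1 / \<alpha>2) (q * \<beta>2 / \<alpha>2)
         (exp ((lam + 2) * lq) / (\<alpha>2 * x)) (q^2 * \<alpha>1 / \<alpha>2) q"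

fun y_lambda :: "params \<Rightarrow> complex \<Rightarrow> complex" where
  "y_lambda (Params q lq \<alpha>1 \<alpha>2 \<beta>1 \<beta>2 l1 l2 lam mu lx) x =
     (q - 1) * exp ((- lam) * lq) * \<alpha>1 * x
     * (qpoch_inf q [q, exp ((- lam + 1) * lq) * \<alpha>1 * x, exp ((- lam) * lq) * \<alpha>2 * x]
        / qpoch_inf q [exp ((- lam + 1) * lq), exp ((- lam) * lq) * \<beta>1 * x, exp ((- lam) * lq) * \<beta>2 * x])
     * phi32 q (exp ((- lam + 1) * lq)) (exp ((- lam) * lq) * \<beta>1 * x) (exp ((- lam) * lq) * \<beta>2 * x)
         (exp ((- lam + 1) * lq) * \<alpha>1 * x) (exp ((- lam) * lq) * \<alpha>2 * x) q"

fun y_beta1 :: "params \<Rightarrow> complex \<Rightarrow> complex" where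
  "y_beta1 (Params q lq \<alpha>1 \<alpha>2 \<beta>1 \<beta>2 l1 l2 lam mu lx) x =
     (1 - q) * exp ((lam - mu) * l1) * exp (lam * lx x)
     * (qpoch_inf q [\<beta>1 * x, q, q * \<beta>1 / \<beta>2]
        / qpoch_inf q [exp ((- lam) * lq) * \<beta>1 * x, \<beta>1 / \<alpha>1, q * \<beta>1 / \<alpha>2])
     * phi32 q (exp ((- lam) * lq) * \<beta>1 * x) (\<beta>1 / \<alpha>1) (q * \<beta>1 / \<alpha>2)
         (\<beta>1 * x) (q * \<beta>1 / \<beta>2) (exp (lam * lq) * \<alpha>1 * \<alpha>2 / (\<beta>1 * \<beta>2))"

fun y_beta2 :: "params \<Rightarrow> complex \<Rightarrow> complex" where
  "y_beta2 (Params q lq \<alpha>1 \<alpha>2 \<beta>1 \<beta>2 l1 l2 lam mu lx) x =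
     (1 - q) * exp ((lam - mu) * l2) * exp (lam * lx x)
     * (qpoch_inf q [\<beta>2 * x, q, q * \<beta>2 / \<beta>1]
        / qpoch_inf q [exp ((- lam) * lq) * \<beta>2 * x, \<beta>2 / \<alpha>1, q * \<beta>2 / \<alpha>2])
     * phi32 q (exp ((- lam) * lq) * \<beta>2 * x) (\<beta>2 / \<alpha>1) (q * \<beta>2 / \<alpha>2)
         (\<beta>2 * x) (q * \<beta>2 / \<beta>1) (exp (lam * lq) * \<alpha>1 * \<alpha>2 / (\<beta>1 * \<beta>2))"

fun y_x :: "params \<Rightarrow> complex \<Rightarrow> complex" where
  "y_x (Params q lq \<alpha>1 \<alpha>2 \<beta>1 \<beta>2 l1 l2 lam mu lx) x =
     (1 - q) * exp ((lam - mu) * lq) * exp (mu * lx x)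
     * (qpoch_inf q [q^2 / (\<beta>1 * x), q^2 / (\<beta>2 * x), q]
        / qpoch_inf q [q / (\<alpha>1 * x), q^2 / (\<alpha>2 * x), exp ((- lam + 1) * lq)])
     * phi32 q (exp ((- lam + 1) * lq)) (q / (\<alpha>1 * x)) (q^2 / (\<alpha>2 * x))
         (q^2 / (\<beta>1 * x)) (q^2 / (\<beta>2 * x)) (exp (lam * lq) * \<alpha>1 * \<alpha>2 / (\<beta>1 * \<beta>2))"

fun J11 :: "params \<Rightarrow> complex \<Rightarrow> complex" where
  "J11 (Params q lq \<alpha>1 \<alpha>2 \<beta>1 \<beta>2 l1 l2 lam mu lx) x =
     - exp ((lam - mu) * l1) * exp (lam * lx x)
     * (theta q (\<beta>1 * x) * theta q (\<alpha>2 / \<beta>2) * theta q (\<beta>2 / \<alpha>1))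
     / (theta q (exp ((- lam) * lq) * \<beta>1 * x) * theta q (\<alpha>1 * \<alpha>2 / (\<beta>1 * \<beta>2)) * theta q (\<alpha>2 / \<alpha>1))"

fun J13 :: "params \<Rightarrow> complex \<Rightarrow> complex" where
  "J13 (Params q lq \<alpha>1 \<alpha>2 \<beta>1 \<beta>2 l1 l2 lam mu lx) x =
     - exp ((- lam + mu) * lq) * exp ((lam - mu) * l1) * exp ((lam - mu) * lx x)
     * (theta q (\<beta>1 * x) * theta q (exp (lam * lq)) * theta q (\<alpha>1 * \<alpha>2 * x / (q * \<beta>2)))
     / (theta q (exp ((- lam) * lq) * \<beta>1 * x) * theta q (\<beta>1 * x / q) * theta q (\<alpha>1 * \<alpha>2 / (\<beta>1 * \<beta>2)))"

fun J21 :: "params \<Rightarrow> complex \<Rightarrow> complex" where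
  "J21 (Params q lq \<alpha>1 \<alpha>2 \<beta>1 \<beta>2 l1 l2 lam mu lx) x =
     - exp ((lam - mu) * l1) * exp (lam * lx x)
     * (theta q (\<alpha>1 * x) * theta q (\<alpha>2 * x / q) * theta q (\<beta>2 / \<beta>1))
     / (theta q (exp ((- lam) * lq) * \<beta>1 * x) * theta q (\<alpha>1 * \<alpha>2 * x / (q * \<beta>1)) * theta q (\<alpha>2 / \<alpha>1))"

fun J23 :: "params \<Rightarrow> complex \<Rightarrow> complex" where
  "J23 (Params q lq \<alpha>1 \<alpha>2 \<beta>1 \<beta>2 l1 l2 lam mu lx) x =
     - (exp ((lam - mu) * l1) / exp ((lam - mu) * l2))
     * (theta q (\<beta>2 / \<beta>1) * theta q (\<alpha>1 * \<alpha>2 * x / (q * \<beta>2)) * theta q (exp ((- lam) * lq) * \<beta>2 * x))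
     / (theta q (exp ((- lam) * lq) * \<beta>1 * x) * theta q (\<beta>1 / \<beta>2) * theta q (\<alpha>1 * \<alpha>2 * x / (q * \<beta>1)))"

fun J31 :: "params \<Rightarrow> complex \<Rightarrow> complex" where
  "J31 (Params q lq \<alpha>1 \<alpha>2 \<beta>1 \<beta>2 l1 l2 lam mu lx) x =
     - (\<alpha>2 / (q * \<alpha>1)) * exp ((lam - mu) * l1) * exp (lam * lx x)
     * (theta q (\<beta>1 * x) * theta q (\<alpha>2 / \<beta>2) * theta q (exp ((- lam) * lq) * \<beta>2 * x))
     / (theta q (\<beta>1 / \<alpha>1) * theta q (exp ((- lam + 1) * lq) * \<beta>1 * \<beta>2 * x / \<alpha>2) * theta q (exp ((- lam - 1) * lq) * \<alpha>2 * x))"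

fun J33 :: "params \<Rightarrow> complex \<Rightarrow> complex" where
  "J33 (Params q lq \<alpha>1 \<alpha>2 \<beta>1 \<beta>2 l1 l2 lam mu lx) x =
     - (exp ((lam - mu) * l1) / exp ((lam - mu) * lq)) * exp ((lam - mu) * lx x)
     * (theta q (\<beta>1 * x) * theta q (\<alpha>1 * x) * theta q (exp ((lam - 1) * lq) * \<alpha>2 / \<beta>2))
     / (theta q (\<beta>1 / \<alpha>1) * theta q (\<beta>1 * x / q) * theta q (exp ((- lam + 1) * lq) * \<beta>1 * \<beta>2 * x / \<alpha>2))"

fun J41 :: "params \<Rightarrow> complex \<Rightarrow> complex" where
  "J41 (Params q lq \<alpha>1 \<alpha>2 \<beta>1 \<beta>2 l1 l2 lam mu lx) x =
     - (\<alpha>2 / (q * \<alpha>1)) * exp ((lam - mu) * l1) * exp (lam * lx x)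
     * (theta q (exp (lam * lq)) * theta q (\<alpha>2 * x / q) * theta q (\<beta>2 / \<beta>1))
     / (theta q (\<beta>1 / \<alpha>1) * theta q (exp ((lam - 1) * lq) * \<alpha>2 / \<beta>1) * theta q (exp ((- lam - 1) * lq) * \<alpha>2 * x))"

fun J43 :: "params \<Rightarrow> complex \<Rightarrow> complex" where
  "J43 (Params q lq \<alpha>1 \<alpha>2 \<beta>1 \<beta>2 l1 l2 lam mu lx) x =
     - (exp ((lam - mu) * l1) / exp ((lam - mu) * l2))
     * (theta q (\<beta>2 / \<beta>1) * theta q (exp ((lam - 1) * lq) * \<alpha>2 / \<beta>2) * theta q (\<beta>2 / \<alpha>1))
     / (theta q (\<beta>1 / \<alpha>1) * theta q (\<beta>1 / \<beta>2) * theta q (exp ((lam - 1) * lq) * \<alpha>2 / \<beta>1))"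

fun J51 :: "params \<Rightarrow> complex \<Rightarrow> complex" where
  "J51 (Params q lq \<alpha>1 \<alpha>2 \<beta>1 \<beta>2 l1 l2 lam mu lx) x =
     - exp ((lam - mu) * l1) * exp (lam * lx x)
     * (theta q (\<beta>1 * x) * theta q (exp ((- lam) * lq) * \<beta>2 * x) * theta q (\<beta>2 / \<alpha>1))
     / (theta q (\<alpha>2 / \<beta>1) * theta q (exp ((- lam) * lq) * \<beta>1 * \<beta>2 * x / \<alpha>1) * theta q (exp ((- lam) * lq) * \<alpha>1 * x))"

fun J53 :: "params \<Rightarrow> complex \<Rightarrow> complex" where
  "J53 (Params q lq \<alpha>1 \<alpha>2 \<beta>1 \<beta>2 l1 l2 lam mu lx) x =
     - (exp ((- lam + mu) * lq) / exp ((- lam + mu) * l1)) * exp ((lam - mu) * lx x)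
     * (theta q (\<beta>1 * x) * theta q (\<alpha>2 * x / q) * theta q (exp (lam * lq) * \<alpha>1 / \<beta>2))
     / (theta q (\<beta>1 * x / q) * theta q (\<alpha>2 / \<beta>1) * theta q (exp ((- lam) * lq) * \<beta>1 * \<beta>2 * x / \<alpha>1))"

fun J61 :: "params \<Rightarrow> complex \<Rightarrow> complex" where
  "J61 (Params q lq \<alpha>1 \<alpha>2 \<beta>1 \<beta>2 l1 l2 lam mu lx) x =
     - exp ((lam - mu) * l1) * exp (lam * lx x)
     * (theta q (exp (lam * lq)) * theta q (\<alpha>1 * x) * theta q (\<beta>2 / \<beta>1))
     / (theta q (\<alpha>2 / \<beta>1) * theta q (exp (lam * lq) * \<alpha>1 / \<beta>1) * theta q (exp ((- lam) * lq) * \<alpha>1 * x))"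

fun J63 :: "params \<Rightarrow> complex \<Rightarrow> complex" where
  "J63 (Params q lq \<alpha>1 \<alpha>2 \<beta>1 \<beta>2 l1 l2 lam mu lx) x =
     - (exp ((lam - mu) * l1) / exp ((lam - mu) * l2))
     * (theta q (\<beta>2 / \<beta>1) * theta q (\<alpha>2 / \<beta>2) * theta q (exp (lam * lq) * \<alpha>1 / \<beta>2))
     / (theta q (\<beta>1 / \<beta>2) * theta q (\<alpha>2 / \<beta>1) * theta q (exp (lam * lq) * \<alpha>1 / \<beta>1))"

definition K11 :: "params \<Rightarrow> complex \<Rightarrow> complex" where
  "K11 P = J11 (swap_beta P)"

definition K13 :: "params \<Rightarrow> complex \<Rightarrow> complex" where
  "K13 P = J13 (swap_beta P)"

definition K31 :: "params \<Rightarrow> complex \<Rightarrow> complex" where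
  "K31 P = J31 (swap_beta P)"

definition K33 :: "params \<Rightarrow> complex \<Rightarrow> complex" where
  "K33 P = J33 (swap_beta P)"

definition K51 :: "params \<Rightarrow> complex \<Rightarrow> complex" where
  "K51 P = J51 (swap_beta P)"

definition K53 :: "params \<Rightarrow> complex \<Rightarrow> complex" where
  "K53 P = J53 (swap_beta P)"

text \<open>
  Genericity means exactly that no denominator vanishes: the first set lists the denominators of
  the prefactors of the six functions, the second one the lower parameters of their
  \<open>\<^sub>3\<phi>\<^sub>2\<close> series, the third one the theta functions in the denominators of the
  coefficients \<open>J\<close> and \<open>K\<close>.
\<close>
fun generic :: "params \<Rightarrow> complex \<Rightarrow> bool" where
  "generic (Params q lq \<alpha>1 \<alpha>2 \<beta>1 \<beta>2 l1 l2 lam mu lx) x \<longleftrightarrow>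
     (\<forall>t \<in> {q / (\<alpha>1 * x), \<beta>1 / \<alpha>1, \<beta>2 / \<alpha>1,
         q^2 / (\<alpha>2 * x), q * \<beta>1 / \<alpha>2, q * \<beta>2 / \<alpha>2,
         exp ((- lam + 1) * lq), exp ((- lam) * lq) * \<beta>1 * x, exp ((- lam) * lq) * \<beta>2 * x}. qpoch_inf q [t] \<noteq> 0) \<and>
     (\<forall>t \<in> {exp ((lam + 1) * lq) / (\<alpha>1 * x), \<alpha>2 / \<alpha>1, exp ((lam + 2) * lq) / (\<alpha>2 * x),
         q^2 * \<alpha>1 / \<alpha>2, exp ((- lam + 1) * lq) * \<alpha>1 * x, exp ((- lam) * lq) * \<alpha>2 * x,
         \<beta>1 * x, q * \<beta>1 / \<beta>2, \<beta>2 * x,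
         q * \<beta>2 / \<beta>1, q^2 / (\<beta>1 * x), q^2 / (\<beta>2 * x)}. \<forall>n. qpoch q [t] n \<noteq> 0) \<and>
     (\<forall>t \<in> {exp ((- lam) * lq) * \<beta>1 * x, exp ((- lam) * lq) * \<beta>2 * x, \<alpha>1 * \<alpha>2 / (\<beta>1 * \<beta>2),
         \<alpha>2 / \<alpha>1, \<beta>1 * x / q, \<beta>2 * x / q,
         \<alpha>1 * \<alpha>2 * x / (q * \<beta>1), \<beta>1 / \<beta>2, \<beta>1 / \<alpha>1,
         \<beta>2 / \<alpha>1, exp ((- lam + 1) * lq) * \<beta>1 * \<beta>2 * x / \<alpha>2, exp ((- lam - 1) * lq) * \<alpha>2 * x,
         exp ((lam - 1) * lq) * \<alpha>2 / \<beta>1, \<alpha>2 / \<beta>1, \<alpha>2 / \<beta>2,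
         exp ((- lam) * lq) * \<beta>1 * \<beta>2 * x / \<alpha>1, exp ((- lam) * lq) * \<alpha>1 * x, exp (lam * lq) * \<alpha>1 / \<beta>1}. theta q t \<noteq> 0)"

text \<open>
  At a pole the value is \<open>0\<close>, as \<open>c / 0 = 0\<close>. The poles of each \<open>J\<close> and \<open>K\<close> (the zeros
  of theta functions) form a set invariant under multiplication by \<open>q\<close>, so quantifying over all
  \<open>x \<noteq> 0\<close> says no more there than \<open>0 = 0\<close>.
\<close>
definition pseudo_constant :: "complex \<Rightarrow> (complex \<Rightarrow> complex) \<Rightarrow> bool" where
  "pseudo_constant q S \<longleftrightarrow> (\<forall>x. x \<noteq> 0 \<longrightarrow> S (q * x) = S x)"

end

theory Submission
  imports Defs "HOL-Computational_Algebra.Polynomial"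
begin

text \<open>
  All the relations are instances of one identity between basic hypergeometric series, and that
  identity says that the residues of one explicit function on the punctured plane add up to zero.

  Put \<open>b = (\<beta>1, \<beta>2, q/x)\<close>, \<open>c = (1/\<alpha>1, q/\<alpha>2, q\<^sup>-\<^sup>\<lambda> x)\<close> and
  \<open>H(t) = t \<Prod>\<^sub>i (q t/c\<^sub>i; q)\<^sub>\<infinity> / (b\<^sub>i t; q)\<^sub>\<infinity>\<close>. Up to factors independent of \<open>n\<close>, the functions
  \<open>y_alpha1, y_alpha2, y_lambda\<close> are the Jackson integrals \<open>\<Sum>\<^sub>n H(c\<^sub>i q\<^sup>n)\<close>, \<open>n \<ge> 0\<close>, and
  \<open>y_beta1, y_beta2, y_x\<close> are the sums of the residues of \<open>H(t) dt/t\<close> at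
  \<open>t = q\<^sup>-\<^sup>n / b\<^sub>i\<close>, \<open>n \<ge> 0\<close>. Both kinds have the same shape, written \<open>nphi\<close> below, with the
  roles of \<open>b\<close> and \<open>c\<close> interchanged, the argument \<open>q\<close> for the first kind and
  \<open>z = q\<^sup>2/(b\<^sub>1b\<^sub>2b\<^sub>3c\<^sub>1c\<^sub>2c\<^sub>3) = q\<^sup>\<lambda>\<alpha>1\<alpha>2/(\<beta>1\<beta>2)\<close> for the second.

  To relate the residue sums at \<open>b\<^sub>1, b\<^sub>2\<close> with the Jackson integrals at \<open>c\<^sub>1, c\<^sub>2\<close>, multiply \<open>H\<close>
  by the elliptic function
  \<open>\<theta>(b\<^sub>3 t) \<theta>(q\<^sup>2 t/(b\<^sub>3c\<^sub>1c\<^sub>2)) / (\<theta>(q t/c\<^sub>1) \<theta>(q t/c\<^sub>2))\<close>, which removes the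
  poles belonging to \<open>b\<^sub>3\<close> and creates simple poles at \<open>c\<^sub>1q\<^sup>n\<close> and \<open>c\<^sub>2q\<^sup>n\<close>, \<open>n \<ge> 0\<close>, those
  with \<open>n < 0\<close> being cancelled by zeros of \<open>H\<close>. With \<open>u = q/(b\<^sub>3c\<^sub>1c\<^sub>2)\<close> the
  product is, up to a constant,
  \<open>(q t/c\<^sub>3, u t, q/(u t), q/(b\<^sub>3 t); q)\<^sub>\<infinity> / (b\<^sub>1 t, b\<^sub>2 t, c\<^sub>1/t, c\<^sub>2/t; q)\<^sub>\<infinity>\<close>.
  When all the infinite products are cut off at a finite level (one factor more in each product of the
  denominator than in those of the numerator), the result times \<open>dt/t\<close> is a rational differential with no residue at \<open>0\<close> and
  \<open>\<infinity>\<close>, so its finitely many residues sum to zero by Lagrange interpolation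
  (\<open>trunc_res_sum\<close>). The residues are dominated by geometric series of ratio \<open>|z|\<close> and \<open>|q|\<close>, so the level can be sent to infinity
  under the sum (\<open>trunc_res_sum_tendsto\<close>). This gives \<open>residue_relation\<close>, and solving it for one of
  the series gives \<open>connection_formula\<close>, whose coefficients are products of theta functions.

  The three pairs \<open>{c\<^sub>i, c\<^sub>j}\<close> and the three pairs \<open>{b\<^sub>i, b\<^sub>j}\<close> give exactly the nine relations.
  Only the reflection \<open>\<theta>(q/t) = \<theta>(t)\<close> is needed to bring the coefficients to the stated form. The
  coefficients are pseudo-constants because of \<open>\<theta>(q t) = -\<theta>(t)/t\<close>.
\<close>

section \<open>Residues of rational functions\<close>

text \<open>
  The left-hand side is the coefficient of degree \<open>card S - 1\<close> in the Lagrange interpolant of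
  \<open>p\<close> at \<open>S\<close>. As the interpolant is \<open>p\<close> itself, that coefficient vanishes. Equivalently, the
  residues of \<open>p dt / \<Prod>\<^sub>s (t - s)\<close> sum to zero, since there is none at infinity.
\<close>
lemma sum_lagrange_weights_eq_0:
  fixes p :: "'a::field poly"
  assumes fin: "finite S" and deg: "degree p + 2 \<le> card S"
  shows "(\<Sum>s\<in>S. poly p s / (\<Prod>r\<in>S - {s}. s - r)) = 0"
proof -
  define L where "L s = (\<Prod>r\<in>S - {s}. [:- r, 1:])" for s
  define w where "w s = (\<Prod>r\<in>S - {s}. s - r)" for s
  define D where "D = (\<Sum>s\<in>S. smult (poly p s / w s) (L s))"
  have degL: "degree (L s) = card S - 1" and lcL: "coeff (L s) (card S - 1) = 1" if "s \<in> S" for s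
  proof -
    have *: "degree (L s) = (\<Sum>r\<in>S - {s}. degree [:- r, 1:])"
      unfolding L_def by (rule degree_prod_eq_sum_degree) auto
    also have "\<dots> = card S - 1"
      using that fin by simp
    finally show **: "degree (L s) = card S - 1" .
    have "lead_coeff (L s) = 1"
      unfolding L_def by (simp add: lead_coeff_prod)
    then show "coeff (L s) (card S - 1) = 1"
      by (simp add: **)
  qed
  have polyL: "poly (L s) s = w s" for s
    by (simp add: L_def w_def poly_prod)
  have polyL0: "poly (L s) t = 0" if "t \<in> S" "s \<noteq> t" for s t
    using that fin by (auto simp: L_def poly_prod)
  have w0: "w s \<noteq> 0" if "s \<in> S" for s
    using fin by (auto simp: w_def)
  have degD: "degree D \<le> card S - 1"
    unfolding D_def using fin degL
    by (intro degree_sum_le) (auto intro: order_trans[OF degree_smult_le])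
  have "p = D"
  proof (rule poly_eqI_degree)
    fix t assume t: "t \<in> S"
    have "poly D t = (\<Sum>s\<in>S. if s = t then poly p t else 0)"
      unfolding D_def poly_sum by (intro sum.cong) (auto simp: polyL w0 polyL0 t)
    then show "poly p t = poly D t"
      using t fin by simp
  qed (use deg degD in auto)
  have "coeff D (card S - 1) = 0"
    unfolding \<open>p = D\<close>[symmetric]
    using deg by (intro coeff_eq_0) auto
  moreover have "coeff D (card S - 1) = (\<Sum>s\<in>S. poly p s / w s)"
    unfolding D_def coeff_sum by (intro sum.cong) (auto simp: lcL simp del: One_nat_def)
  ultimately show ?thesis
    by (simp add: w_def)
qed

text \<open>
  The same vanishing, with the linear factors normalised to \<open>1 - t/s\<close> for the poles that will escape
  to infinity and to \<open>1 - r/t\<close> for those that will accumulate at \<open>0\<close>. The renormalisation only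
  contributes the common constant \<open>\<kappa>\<close>, apart from the sign that separates the two sides.
\<close>
lemma laurent_residue_sum:
  fixes p :: "'a::field poly"
  assumes fin: "finite S" "finite R" and disj: "S \<inter> R = {}" and nz: "0 \<notin> S" "0 \<notin> R"
    and deg: "degree p + 2 \<le> card S + card R" and R: "card R = Suc m"
  shows "(\<Sum>s\<in>S. poly p s / s ^ m / ((\<Prod>s'\<in>S - {s}. 1 - s / s') * (\<Prod>r\<in>R. 1 - r / s)))
    = (\<Sum>r\<in>R. poly p r / r ^ m / ((\<Prod>r'\<in>R - {r}. 1 - r' / r) * (\<Prod>s\<in>S. 1 - r / s)))"
proof -
  define \<kappa> where "\<kappa> = (\<Prod>s\<in>S. - s)"
  have \<kappa>: "\<kappa> \<noteq> 0"
    using nz fin by (auto simp: \<kappa>_def)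
  have pull: "(\<Prod>s'\<in>T. 1 - t / s') * (\<Prod>s'\<in>T. - s') = (\<Prod>s'\<in>T. t - s')" if "T \<subseteq> S" for T t
    unfolding prod.distrib[symmetric] using that nz by (intro prod.cong) (auto simp: field_simps)
  have pull': "(\<Prod>r\<in>T. 1 - r / t) * t ^ card T = (\<Prod>r\<in>T. t - r)" if "T \<subseteq> R" "t \<noteq> 0" for T t
    unfolding prod_constant[symmetric] prod.distrib[symmetric] using that
    by (intro prod.cong) (auto simp: field_simps)
  have s: "poly p s / (\<Prod>t\<in>S \<union> R - {s}. s - t)
      = - (poly p s / s ^ m / ((\<Prod>s'\<in>S - {s}. 1 - s / s') * (\<Prod>r\<in>R. 1 - r / s))) / \<kappa>"
    if "s \<in> S" for s
  proof -
    have "s \<noteq> 0"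
      using that nz by auto
    have "(\<Prod>s'\<in>S - {s}. - s') = - \<kappa> / s"
      using that fin nz \<open>s \<noteq> 0\<close> by (simp add: \<kappa>_def prod_diff1)
    then have "(\<Prod>s'\<in>S - {s}. s - s') = (\<Prod>s'\<in>S - {s}. 1 - s / s') * (- \<kappa> / s)"
      using pull[of "S - {s}" s] by simp
    moreover have "(\<Prod>r\<in>R. s - r) = (\<Prod>r\<in>R. 1 - r / s) * s ^ Suc m"
      using pull'[of R s] \<open>s \<noteq> 0\<close> R by simp
    moreover have "S \<union> R - {s} = (S - {s}) \<union> R"
      using that disj by auto
    then have "(\<Prod>t\<in>S \<union> R - {s}. s - t) = (\<Prod>s'\<in>S - {s}. s - s') * (\<Prod>r\<in>R. s - r)"
      using fin disj by (simp, subst prod.union_disjoint) auto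
    moreover have "w / (x * (- \<kappa> / s) * (y * s ^ Suc m)) = - (w / s ^ m / (x * y)) / \<kappa>" for w x y
      using \<open>s \<noteq> 0\<close> \<kappa> by (cases "x = 0"; cases "y = 0") (auto simp: field_simps)
    ultimately show ?thesis
      by simp
  qed
  have r: "poly p r / (\<Prod>t\<in>S \<union> R - {r}. r - t)
      = poly p r / r ^ m / ((\<Prod>r'\<in>R - {r}. 1 - r' / r) * (\<Prod>s\<in>S. 1 - r / s)) / \<kappa>"
    if "r \<in> R" for r
  proof -
    have "r \<noteq> 0"
      using that nz by auto
    have "card (R - {r}) = m"
      using that R by simp
    then have "(\<Prod>r'\<in>R - {r}. r - r') = (\<Prod>r'\<in>R - {r}. 1 - r' / r) * r ^ m"
      using pull'[of "R - {r}" r] \<open>r \<noteq> 0\<close> by simp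
    moreover have "(\<Prod>s\<in>S. r - s) = (\<Prod>s\<in>S. 1 - r / s) * \<kappa>"
      using pull[of S r] by (simp add: \<kappa>_def)
    moreover have "S \<union> R - {r} = S \<union> (R - {r})"
      using that disj by auto
    then have "(\<Prod>t\<in>S \<union> R - {r}. r - t) = (\<Prod>s\<in>S. r - s) * (\<Prod>r'\<in>R - {r}. r - r')"
      using fin disj by (simp, subst prod.union_disjoint) auto
    ultimately show ?thesis
      by (simp add: mult_ac)
  qed
  have "card (S \<union> R) = card S + card R"
    using fin disj by (intro card_Un_disjoint)
  then have "(\<Sum>t\<in>S \<union> R. poly p t / (\<Prod>t'\<in>S \<union> R - {t}. t - t')) = 0"
    using fin deg by (intro sum_lagrange_weights_eq_0) auto
  then have "(\<Sum>s\<in>S. - (poly p s / s ^ m / ((\<Prod>s'\<in>S - {s}. 1 - s / s') * (\<Prod>r\<in>R. 1 - r / s))) / \<kappa>)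
      + (\<Sum>r\<in>R. poly p r / r ^ m / ((\<Prod>r'\<in>R - {r}. 1 - r' / r) * (\<Prod>s\<in>S. 1 - r / s)) / \<kappa>) = 0"
    using fin disj by (simp add: sum.union_disjoint s r cong: sum.cong)
  then show ?thesis
    unfolding sum_divide_distrib[symmetric] sum_negf using \<kappa>
    by (simp add: add_divide_distrib[symmetric] flip: minus_divide_left)
qed

section \<open>The q-shifted factorials\<close>

locale q_disc =
  fixes q :: complex
  assumes q_nz: "q \<noteq> 0" and q_lt: "norm q < 1"
begin

definition poch :: "complex \<Rightarrow> nat \<Rightarrow> complex" where
  "poch a n = (\<Prod>j<n. 1 - q ^ j * a)"

definition pinf :: "complex \<Rightarrow> complex" where
  "pinf a = prodinf (\<lambda>j. 1 - q ^ j * a)"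

lemma poch_0 [simp]: "poch a 0 = 1"
  and poch_Suc: "poch a (Suc n) = poch a n * (1 - q ^ n * a)"
  by (simp_all add: poch_def)

lemma poch_add: "poch a (m + n) = poch a m * poch (q ^ m * a) n"
  by (induction n) (simp_all add: poch_Suc power_add mult_ac)

lemma poch_convergent: "convergent_prod (\<lambda>j. 1 - q ^ j * a)"
proof (intro abs_convergent_prod_imp_convergent_prod summable_imp_abs_convergent_prod)
  have "summable (\<lambda>j. norm q ^ j * norm a)"
    using q_lt by (intro summable_mult2 summable_geometric) auto
  then show "summable (\<lambda>j. norm (1 - q ^ j * a - 1))"
    by (simp add: norm_mult norm_power)
qed

lemma poch_tendsto: "(\<lambda>n. poch a n) \<longlonglongrightarrow> pinf a"
  using convergent_prod_LIMSEQ[OF poch_convergent[of a]]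
  unfolding poch_def pinf_def by (subst (asm) LIMSEQ_lessThan_iff_atMost[symmetric])

lemma pinf_split: "pinf a = poch a n * pinf (q ^ n * a)"
proof -
  have "(\<lambda>m. poch a (n + m)) \<longlonglongrightarrow> poch a n * pinf (q ^ n * a)"
    unfolding poch_add by (intro tendsto_intros poch_tendsto)
  moreover have "(\<lambda>m. poch a (n + m)) \<longlonglongrightarrow> pinf a"
    using poch_tendsto LIMSEQ_ignore_initial_segment[of "poch a" "pinf a" n] by (simp add: add.commute)
  ultimately show ?thesis
    using LIMSEQ_unique by blast
qed

lemma qpoch_singleton: "qpoch q [a] n = poch a n"
  and qpoch_inf_singleton: "qpoch_inf q [a] = pinf a"
  by (simp_all add: qpoch_def qpoch_inf_def poch_def pinf_def)

lemma pinf_nonzero_iff: "pinf a \<noteq> 0 \<longleftrightarrow> (\<forall>n. poch a n \<noteq> 0)"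
proof
  assume "pinf a \<noteq> 0"
  then show "\<forall>n. poch a n \<noteq> 0"
    using pinf_split by (metis mult_zero_left)
next
  assume *: "\<forall>n. poch a n \<noteq> 0"
  have "1 - q ^ n * a \<noteq> 0" for n
    using *[rule_format, of "Suc n"] by (simp add: poch_Suc)
  then show "pinf a \<noteq> 0"
    unfolding pinf_def by (intro prodinf_nonzero poch_convergent)
qed

lemma pinf_nonzeroD: "pinf a \<noteq> 0 \<Longrightarrow> poch a n \<noteq> 0"
  by (simp add: pinf_nonzero_iff)

lemma pinf_nonzero_factor: "pinf a \<noteq> 0 \<Longrightarrow> 1 - q ^ n * a \<noteq> 0"
  using pinf_nonzeroD[of a "Suc n"] by (simp add: poch_Suc)

lemma pinf_q_nonzero: "pinf q \<noteq> 0"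
proof -
  have "norm (q ^ j * q) < 1" for j
    using power_Suc_less_one[of "norm q" j] q_lt q_nz by (simp add: norm_mult norm_power mult.commute)
  then have "q ^ j * q \<noteq> 1" for j
    by (metis norm_one less_irrefl)
  then have "poch q n \<noteq> 0" for n
    by (simp add: poch_def)
  then show ?thesis
    by (simp add: pinf_nonzero_iff)
qed

text \<open>
  The bound depends neither on \<open>n\<close> nor on \<open>N\<close>; this uniformity is what dominated convergence of the
  residue sums needs.
\<close>
lemma norm_poch_shift_le:
  "norm (poch (q ^ n * a) N) \<le> exp (norm a / (1 - norm q))"
proof -
  have "norm (poch (q ^ n * a) N) \<le> (\<Prod>j<N. 1 + norm q ^ j * norm a)"
    unfolding poch_def prod_norm[symmetric]
  proof (intro prod_mono conjI norm_ge_zero)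
    fix j
    have "norm (1 - q ^ j * (q ^ n * a)) \<le> norm (1::complex) + norm (q ^ j * (q ^ n * a))"
      by (rule norm_triangle_ineq4)
    also have "norm (q ^ j * (q ^ n * a)) = norm q ^ n * (norm q ^ j * norm a)"
      by (simp add: norm_mult norm_power)
    also have "\<dots> \<le> 1 * (norm q ^ j * norm a)"
      using q_lt by (intro mult_right_mono power_le_one) auto
    finally show "norm (1 - q ^ j * (q ^ n * a)) \<le> 1 + norm q ^ j * norm a"
      by simp
  qed
  also have "\<dots> \<le> (\<Prod>j<N. exp (norm q ^ j * norm a))"
    by (intro prod_mono) (auto simp: add_nonneg_nonneg)
  also have "\<dots> = exp ((\<Sum>j<N. norm q ^ j) * norm a)"
    by (simp add: exp_sum sum_distrib_right)
  also have "(\<Sum>j<N. norm q ^ j) * norm a \<le> (1 / (1 - norm q)) * norm a"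
  proof (intro mult_right_mono norm_ge_zero)
    have "(\<Sum>j<N. norm q ^ j) \<le> (\<Sum>j. norm q ^ j)"
      using q_lt by (intro sum_le_suminf summable_geometric) auto
    also have "\<dots> = 1 / (1 - norm q)"
      using q_lt by (intro suminf_geometric) auto
    finally show "(\<Sum>j<N. norm q ^ j) \<le> 1 / (1 - norm q)" .
  qed
  finally show ?thesis by simp
qed

lemma inverse_poch_bounded:
  assumes "pinf a \<noteq> 0"
  obtains C where "C > 0" "\<And>n N. norm (inverse (poch (q ^ n * a) N)) \<le> C"
proof -
  have "(\<lambda>n. inverse (poch a n)) \<longlonglongrightarrow> inverse (pinf a)"
    using assms by (intro tendsto_intros poch_tendsto)
  then obtain B where B: "B > 0" "\<And>n. norm (inverse (poch a n)) \<le> B"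
    using convergent_imp_Bseq[OF convergentI] by (metis BseqE)
  define C where "C = exp (norm a / (1 - norm q))"
  have C: "C > 0" "norm (poch (q ^ n * a) N) \<le> C" for n N
    using norm_poch_shift_le by (simp_all add: C_def)
  have "norm (inverse (poch (q ^ n * a) N)) \<le> C * B" for n N
  proof -
    have "poch a n \<noteq> 0"
      using assms by (rule pinf_nonzeroD)
    then have "inverse (poch (q ^ n * a) N) = poch a n * inverse (poch a (n + N))"
      by (simp add: poch_add)
    then show ?thesis
      using C(2)[of 0 n] B(2)[of "n + N"] C(1) by (simp add: norm_mult mult_mono)
  qed
  then show ?thesis
    using that[of "C * B"] B(1) C(1) by simp
qed

text \<open>
  The reversal of the factors with negative powers of \<open>q\<close>. It separates a residue at
  \<open>q\<^sup>-\<^sup>n / b\<close> into a factor that has a limit and powers of \<open>q\<close> that cancel between numerator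
  and denominator.
\<close>
lemma poch_shift_back:
  assumes "a \<noteq> 0" "n \<le> M"
  shows "poch (a / q ^ n) M = (- a) ^ n / (\<Prod>i<n. q ^ Suc i) * poch (q / a) n * poch a (M - n)"
proof -
  have "poch (a / q ^ n) M = poch (a / q ^ n) n * poch a (M - n)"
    using poch_add[of "a / q ^ n" n "M - n"] assms q_nz by simp
  also have "poch (a / q ^ n) n = (\<Prod>i<n. 1 - q ^ (n - Suc i) * (a / q ^ n))"
    unfolding poch_def by (rule prod.nat_diff_reindex[symmetric])
  also have "\<dots> = (\<Prod>i<n. (- a) / q ^ Suc i * (1 - q ^ i * (q / a)))"
  proof (intro prod.cong refl)
    fix i assume "i \<in> {..<n}"
    then have "q ^ n = q ^ (n - Suc i) * q ^ Suc i"
      unfolding power_add[symmetric] by simp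
    then show "1 - q ^ (n - Suc i) * (a / q ^ n) = (- a) / q ^ Suc i * (1 - q ^ i * (q / a))"
      using q_nz assms by (simp add: field_simps)
  qed
  also have "\<dots> = (- a) ^ n / (\<Prod>i<n. q ^ Suc i) * poch (q / a) n"
    unfolding prod.distrib prod_dividef poch_def by simp
  finally show ?thesis .
qed

text \<open>The case \<open>a = 1\<close> without its vanishing factor, as it occurs in the residue at a simple pole.\<close>
lemma prod_omit_zero_factor:
  assumes "n \<le> N"
  shows "(\<Prod>j\<in>{..N} - {n}. 1 - q ^ j / q ^ n)
    = (- 1) ^ n / (\<Prod>i<n. q ^ Suc i) * poch q n * poch q (N - n)"
proof -
  have split: "{..N} - {n} = {..<n} \<union> {Suc n..<Suc N}"
    using assms by auto
  have "(\<Prod>j\<in>{..N} - {n}. 1 - q ^ j / q ^ n)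
      = (\<Prod>j<n. 1 - q ^ j * (1 / q ^ n)) * (\<Prod>j\<in>{Suc n..<Suc N}. 1 - q ^ j / q ^ n)"
    unfolding split by (subst prod.union_disjoint) auto
  also have "(\<Prod>j<n. 1 - q ^ j * (1 / q ^ n)) = (- 1) ^ n / (\<Prod>i<n. q ^ Suc i) * poch q n"
    using poch_shift_back[of 1 n n] by (simp add: poch_def)
  also have "(\<Prod>j\<in>{Suc n..<Suc N}. 1 - q ^ j / q ^ n) = (\<Prod>j<N - n. 1 - q ^ (j + Suc n) / q ^ n)"
    using prod.shift_bounds_nat_ivl[of "\<lambda>j. 1 - q ^ j / q ^ n" 0 "Suc n" "N - n"] assms
    by (simp add: lessThan_atLeast0)
  also have "\<dots> = poch q (N - n)"
    using q_nz by (simp add: poch_def power_add mult_ac)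
  finally show ?thesis .
qed

lemma theta_eq: "theta q t = pinf t * pinf (q / t) * pinf q"
  by (simp add: theta_def qpoch_inf_def pinf_def)

lemma theta_reflect: "t \<noteq> 0 \<Longrightarrow> theta q (q / t) = theta q t"
  using q_nz by (simp add: theta_eq)

lemma theta_q_mult:
  assumes "t \<noteq> 0"
  shows "theta q (q * t) = - theta q t / t"
proof -
  have t: "pinf t = (1 - t) * pinf (q * t)" and r: "pinf (1 / t) = (1 - 1 / t) * pinf (q / t)"
    using pinf_split[of t 1] pinf_split[of "1 / t" 1] by (simp_all add: poch_Suc)
  have "theta q (q * t) = pinf (q * t) * pinf (1 / t) * pinf q"
    using q_nz by (simp add: theta_eq)
  also have "\<dots> = - ((1 - t) * pinf (q * t)) * pinf (q / t) * pinf q / t"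
    using assms by (simp add: r field_simps)
  finally show ?thesis
    by (simp add: theta_eq t)
qed

section \<open>The residue sums at finite level\<close>

text \<open>
  The residue at \<open>t = q\<^sup>-\<^sup>n / b1\<close> of
  \<open>(A t, B t, C/t, D/t; q)\<^sub>N / (b1 t, b2 t, d1/t, d2/t; q)\<^sub>N\<^sub>+\<^sub>1 dt/t\<close>, up to sign, where
  \<open>\<alpha> = A/b1\<close>, \<open>\<beta> = B/b1\<close>, \<open>\<gamma> = b2/b1\<close>, \<open>c = C b1\<close>, \<open>d = D b1\<close>, \<open>e = d1 b1\<close>,
  \<open>f = d2 b1\<close>. By the symmetry \<open>t \<mapsto> 1/t\<close> the same expression describes the residues at
  \<open>t = d1 q\<^sup>n\<close>.
\<close>
definition trunc_res ::
  "complex \<Rightarrow> complex \<Rightarrow> complex \<Rightarrow> complex \<Rightarrow> complex \<Rightarrow> complex \<Rightarrow> complex \<Rightarrow> nat \<Rightarrow> nat \<Rightarrow> complex" where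
  "trunc_res \<alpha> \<beta> \<gamma> c d e f N n =
     poch (\<alpha> / q ^ n) N * poch (\<beta> / q ^ n) N * poch (q ^ n * c) N * poch (q ^ n * d) N
     / ((\<Prod>j\<in>{..N} - {n}. 1 - q ^ j / q ^ n) * poch (\<gamma> / q ^ n) (Suc N)
        * poch (q ^ n * e) (Suc N) * poch (q ^ n * f) (Suc N))"

text \<open>
  The negative powers of \<open>q\<close> in numerator and denominator cancel, so that apart from bounded factors
  only the \<open>n\<close>-th power of \<open>\<alpha>\<beta>/\<gamma>\<close> remains.
\<close>
lemma trunc_res_eq:
  assumes "n \<le> N" "\<alpha> \<noteq> 0" "\<beta> \<noteq> 0" "\<gamma> \<noteq> 0"
  shows "trunc_res \<alpha> \<beta> \<gamma> c d e f N n = (\<alpha> * \<beta> / \<gamma>) ^ n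
    * (poch (q / \<alpha>) n * poch (q / \<beta>) n * poch \<alpha> (N - n) * poch \<beta> (N - n)
       * poch (q ^ n * c) N * poch (q ^ n * d) N)
    / (poch q n * poch (q / \<gamma>) n * poch q (N - n) * poch \<gamma> (Suc N - n)
       * poch (q ^ n * e) (Suc N) * poch (q ^ n * f) (Suc N))"
proof -
  define Q where "Q = (\<Prod>i<n. q ^ Suc i)"
  have Q: "Q \<noteq> 0"
    using q_nz by (simp add: Q_def)
  have sign: "(- \<alpha>) ^ n * (- \<beta>) ^ n = (\<alpha> * \<beta> / \<gamma>) ^ n * ((- 1) ^ n * (- \<gamma>) ^ n)"
    using assms by (simp flip: power_mult_distrib)
  have u: "((- 1) ^ n * (- \<gamma>) ^ n) \<noteq> 0"
    using assms by simp
  have *: "poch (\<alpha> / q ^ n) N = (- \<alpha>) ^ n / Q * poch (q / \<alpha>) n * poch \<alpha> (N - n)"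
    "poch (\<beta> / q ^ n) N = (- \<beta>) ^ n / Q * poch (q / \<beta>) n * poch \<beta> (N - n)"
    "poch (\<gamma> / q ^ n) (Suc N) = (- \<gamma>) ^ n / Q * poch (q / \<gamma>) n * poch \<gamma> (Suc N - n)"
    "(\<Prod>j\<in>{..N} - {n}. 1 - q ^ j / q ^ n) = (- 1) ^ n / Q * poch q n * poch q (N - n)"
    unfolding Q_def
    using poch_shift_back[OF assms(2,1)] poch_shift_back[OF assms(3,1)]
      poch_shift_back[of \<gamma> n "Suc N"] prod_omit_zero_factor[OF assms(1)] assms by auto
  have cancel: "(a1 / Q * x1 * y1) * (a2 / Q * x2 * y2) * v1 * v2
      / ((a3 / Q * x3 * y3) * (a4 / Q * x4 * y4) * v3 * v4)
    = w * (x1 * x2 * y1 * y2 * v1 * v2) / (x3 * x4 * y3 * y4 * v3 * v4)"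
    if "a1 * a2 = w * (a3 * a4)" "a3 * a4 \<noteq> 0"
    for a1 a2 a3 a4 x1 x2 x3 x4 y1 y2 y3 y4 v1 v2 v3 v4 w :: complex
  proof -
    have "(a1 / Q * x1 * y1) * (a2 / Q * x2 * y2) * v1 * v2
      / ((a3 / Q * x3 * y3) * (a4 / Q * x4 * y4) * v3 * v4)
      = ((a1 * a2) * (x1 * x2 * y1 * y2 * v1 * v2)) / ((a3 * a4) * (x3 * x4 * y3 * y4 * v3 * v4))"
      using Q by (simp add: mult_ac)
    then show ?thesis
      using that by (simp add: mult_ac)
  qed
  show ?thesis
    unfolding trunc_res_def * by (rule cancel[OF sign u])
qed

text \<open>
  The numerator of the truncated differential, times the power of \<open>t\<close> that makes it a polynomial.
  The exponent \<open>2 * N + 1\<close> is one less than the number of poles of the form \<open>d q\<^sup>j\<close>, because of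
  the factor \<open>dt/t\<close>.
\<close>
lemma truncated_numerator_poly:
  fixes A B C D :: complex and N :: nat
  defines "p \<equiv> [:0, 1:] * (\<Prod>j<N. [:1, - (q ^ j * A):] * [:1, - (q ^ j * B):] * [:- (q ^ j * C), 1:] * [:- (q ^ j * D), 1:])"
  shows "degree p \<le> 4 * N + 1"
    and "t \<noteq> 0 \<Longrightarrow> poly p t / t ^ (2 * N + 1) = poch (A * t) N * poch (B * t) N * poch (C / t) N * poch (D / t) N"
proof -
  have lin: "degree [:a, b:] \<le> 1" for a b :: complex
    by simp
  have "degree ([:1, - (q ^ j * A):] * [:1, - (q ^ j * B):] * [:- (q ^ j * C), 1:] * [:- (q ^ j * D), 1:]) \<le> 1 + 1 + 1 + 1" for j
    by (intro order_trans[OF degree_mult_le] add_mono lin)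
  then have "degree (\<Prod>j<N. [:1, - (q ^ j * A):] * [:1, - (q ^ j * B):] * [:- (q ^ j * C), 1:] * [:- (q ^ j * D), 1:]) \<le> (\<Sum>j<N. 4)"
    by (intro order_trans[OF degree_prod_sum_le] sum_mono) auto
  then show "degree p \<le> 4 * N + 1"
    unfolding p_def by (intro order_trans[OF degree_mult_le]) auto
  assume t: "t \<noteq> 0"
  have fac: "(\<Prod>j<N. t - q ^ j * E) = t ^ N * poch (E / t) N" for E
    unfolding poch_def using t prod.distrib[of "\<lambda>_. t" "\<lambda>j. 1 - q ^ j * (E / t)" "{..<N}"]
    by (auto simp: right_diff_distrib)
  have fac': "(\<Prod>j<N. 1 - q ^ j * E * t) = poch (E * t) N" for E
    by (simp add: poch_def mult_ac)
  have "poly p t = t * ((\<Prod>j<N. 1 - q ^ j * A * t) * (\<Prod>j<N. 1 - q ^ j * B * t)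
      * (\<Prod>j<N. t - q ^ j * C) * (\<Prod>j<N. t - q ^ j * D))"
    unfolding p_def poly_mult poly_prod prod.distrib by (simp add: mult_ac)
  then show "poly p t / t ^ (2 * N + 1) = poch (A * t) N * poch (B * t) N * poch (C / t) N * poch (D / t) N"
    unfolding fac fac' using t by (simp add: power_add mult_2)
qed

lemma sum_prod_two_families:
  fixes g g' :: "nat \<Rightarrow> complex" and h :: "complex \<Rightarrow> complex"
  assumes "inj_on g {..N}" "inj_on g' {..N}" "\<And>i j. g i \<noteq> g' j"
  defines "S \<equiv> g ` {..N} \<union> g' ` {..N}"
  shows "finite S" "card S = 2 * N + 2"
    and "sum h S = (\<Sum>n\<le>N. h (g n)) + (\<Sum>n\<le>N. h (g' n))"
    and "prod h S = (\<Prod>j\<le>N. h (g j)) * (\<Prod>j\<le>N. h (g' j))"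
    and "n \<le> N \<Longrightarrow> prod h (S - {g n}) = (\<Prod>j\<in>{..N} - {n}. h (g j)) * (\<Prod>j\<le>N. h (g' j))"
    and "n \<le> N \<Longrightarrow> prod h (S - {g' n}) = (\<Prod>j\<in>{..N} - {n}. h (g' j)) * (\<Prod>j\<le>N. h (g j))"
proof -
  have disj: "g ` {..N} \<inter> g' ` {..N} = {}"
    using assms(3) by auto
  show "finite S" by (simp add: S_def)
  show "card S = 2 * N + 2"
    unfolding S_def using disj by (subst card_Un_disjoint) (auto simp: card_image assms)
  show "sum h S = (\<Sum>n\<le>N. h (g n)) + (\<Sum>n\<le>N. h (g' n))"
    unfolding S_def using disj by (subst sum.union_disjoint) (auto simp: sum.reindex assms)
  show "prod h S = (\<Prod>j\<le>N. h (g j)) * (\<Prod>j\<le>N. h (g' j))"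
    unfolding S_def using disj by (subst prod.union_disjoint) (auto simp: prod.reindex assms)
  show "prod h (S - {g n}) = (\<Prod>j\<in>{..N} - {n}. h (g j)) * (\<Prod>j\<le>N. h (g' j))" if "n \<le> N"
  proof -
    have "S - {g n} = g ` ({..N} - {n}) \<union> g' ` {..N}"
      unfolding S_def using assms(3) inj_on_eq_iff[OF assms(1)] that by (auto; metis atMost_iff)
    moreover have "inj_on g ({..N} - {n})"
      using assms(1) by (rule inj_on_subset) auto
    ultimately show ?thesis
      using assms(2,3) by (simp, subst prod.union_disjoint) (auto simp: prod.reindex)
  qed
  show "prod h (S - {g' n}) = (\<Prod>j\<in>{..N} - {n}. h (g' j)) * (\<Prod>j\<le>N. h (g j))" if "n \<le> N"
  proof -
    have "S - {g' n} = g' ` ({..N} - {n}) \<union> g ` {..N}"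
      unfolding S_def using assms(3) inj_on_eq_iff[OF assms(2)] that by (auto; metis atMost_iff)
    moreover have "inj_on g' ({..N} - {n})"
      using assms(2) by (rule inj_on_subset) auto
    moreover have "\<And>i j. g' i \<noteq> g j"
      using assms(3) by metis
    ultimately show ?thesis
      using assms(1) by (simp, subst prod.union_disjoint) (auto simp: prod.reindex)
  qed
qed

lemma q_power_eq_iff: "q ^ i = q ^ j \<longleftrightarrow> i = j"
proof -
  have "norm q ^ i = norm q ^ j \<Longrightarrow> i = j"
    using q_lt q_nz power_inject_exp'[of "norm q" i j] by (metis linorder_neqE_nat power_strict_decreasing zero_less_norm_iff less_irrefl)
  then show ?thesis
    by (metis norm_power)
qed

lemma theta_nonzeroD:
  assumes "theta q t \<noteq> 0"
  shows "pinf t \<noteq> 0" "pinf (q / t) \<noteq> 0"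
  using assms by (auto simp: theta_eq)

text \<open>A theta function vanishes exactly on powers of \<open>q\<close>, so this keeps two strings of poles apart.\<close>
lemma theta_nonzero_distinct:
  assumes "theta q (b' / b) \<noteq> 0" "b \<noteq> 0" "b' \<noteq> 0"
  shows "q ^ i * b \<noteq> q ^ j * b'"
proof (cases "i \<le> j")
  case True
  then have "q ^ j = q ^ i * q ^ (j - i)"
    unfolding power_add[symmetric] by simp
  then show ?thesis
    using pinf_nonzero_factor[OF theta_nonzeroD(1)[OF assms(1)], of "j - i"] assms q_nz
    by (auto simp: field_simps)
next
  case False
  then have "q ^ i = q ^ j * (q ^ (i - Suc j) * q)"
    unfolding power_add[symmetric] power_Suc2[symmetric] by simp
  then show ?thesis
    using pinf_nonzero_factor[OF theta_nonzeroD(2)[OF assms(1)], of "i - Suc j"] assms q_nz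
    by (auto simp: field_simps)
qed

text \<open>
  The residue theorem for the truncated differential: the poles \<open>q\<^sup>-\<^sup>n / b1\<close>, \<open>q\<^sup>-\<^sup>n / b2\<close> on
  the left, \<open>d1 q\<^sup>n\<close>, \<open>d2 q\<^sup>n\<close> on the right. There are \<open>4 * N + 4\<close> of them and the numerator has degree
  at most \<open>4 * N + 1\<close>, so nothing is left at \<open>0\<close> and \<open>\<infinity>\<close>.
\<close>
lemma trunc_res_sum:
  fixes A B C D b1 b2 d1 d2 :: complex
  assumes nz: "b1 \<noteq> 0" "b2 \<noteq> 0" "d1 \<noteq> 0" "d2 \<noteq> 0"
    and th: "theta q (b2 / b1) \<noteq> 0" "theta q (d2 / d1) \<noteq> 0"
    and p: "pinf (b1 * d1) \<noteq> 0" "pinf (b1 * d2) \<noteq> 0" "pinf (b2 * d1) \<noteq> 0" "pinf (b2 * d2) \<noteq> 0"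
  shows "(\<Sum>n\<le>N. trunc_res (A / b1) (B / b1) (b2 / b1) (C * b1) (D * b1) (b1 * d1) (b1 * d2) N n)
       + (\<Sum>n\<le>N. trunc_res (A / b2) (B / b2) (b1 / b2) (C * b2) (D * b2) (b2 * d1) (b2 * d2) N n)
       = (\<Sum>n\<le>N. trunc_res (D / d1) (C / d1) (d2 / d1) (B * d1) (A * d1) (b1 * d1) (b2 * d1) N n)
       + (\<Sum>n\<le>N. trunc_res (D / d2) (C / d2) (d1 / d2) (B * d2) (A * d2) (b1 * d2) (b2 * d2) N n)"
proof -
  define g1 g2 h1 h2 where "g1 n = 1 / (q ^ n * b1)" and "g2 n = 1 / (q ^ n * b2)"
    and "h1 n = q ^ n * d1" and "h2 n = q ^ n * d2" for n
  note gdefs = g1_def g2_def h1_def h2_def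
  define S where "S = g1 ` {..N} \<union> g2 ` {..N}"
  define R where "R = h1 ` {..N} \<union> h2 ` {..N}"
  define pp where "pp = [:0, 1:] * (\<Prod>j<N. [:1, - (q ^ j * A):] * [:1, - (q ^ j * B):] * [:- (q ^ j * C), 1:] * [:- (q ^ j * D), 1:])"
  have nz': "g1 n \<noteq> 0" "g2 n \<noteq> 0" "h1 n \<noteq> 0" "h2 n \<noteq> 0" for n
    using nz q_nz by (auto simp: gdefs)
  have inj: "inj_on g1 {..N}" "inj_on g2 {..N}" "inj_on h1 {..N}" "inj_on h2 {..N}"
    using nz q_nz by (auto simp: inj_on_def gdefs q_power_eq_iff)
  have ne: "g1 i \<noteq> g2 j" "h1 i \<noteq> h2 j" for i j
    using theta_nonzero_distinct[OF th(1) nz(1,2), of i j] theta_nonzero_distinct[OF th(2) nz(3,4), of i j] nz q_nz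
    by (auto simp: gdefs field_simps)
  have neq: "1 / (q ^ i * b) \<noteq> q ^ j * d" if "pinf (b * d) \<noteq> 0" "b \<noteq> 0" for i j b d
    using pinf_nonzero_factor[OF that(1), of "i + j"] that q_nz by (auto simp: field_simps power_add)
  have disj: "S \<inter> R = {}"
    using neq p nz by (auto simp: S_def R_def gdefs)
  note S = sum_prod_two_families[OF inj(1,2) ne(1), folded S_def]
  note R = sum_prod_two_families[OF inj(3,4) ne(2), folded R_def]
  note pp = truncated_numerator_poly[where A = A and B = B and C = C and D = D and N = N, folded pp_def]
  have "(\<Sum>s\<in>S. poly pp s / s ^ (2 * N + 1) / ((\<Prod>s'\<in>S - {s}. 1 - s / s') * (\<Prod>r\<in>R. 1 - r / s)))
    = (\<Sum>r\<in>R. poly pp r / r ^ (2 * N + 1) / ((\<Prod>r'\<in>R - {r}. 1 - r' / r) * (\<Prod>s\<in>S. 1 - r / s)))"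
  proof (rule laurent_residue_sum)
    show "0 \<notin> S" "0 \<notin> R"
      using nz' by (force simp: S_def R_def)+
    show "degree pp + 2 \<le> card S + card R"
      using pp(1) S(2) R(2) by simp
  qed (use S R disj in auto)
  moreover have "poly pp (g1 n) / g1 n ^ (2 * N + 1) / ((\<Prod>s'\<in>S - {g1 n}. 1 - g1 n / s') * (\<Prod>r\<in>R. 1 - r / g1 n))
     = trunc_res (A / b1) (B / b1) (b2 / b1) (C * b1) (D * b1) (b1 * d1) (b1 * d2) N n" if "n \<le> N" for n
    unfolding pp(2)[OF nz'(1)] S(5)[OF that] R(4) trunc_res_def
    unfolding poch_def lessThan_Suc_atMost gdefs
    using nz q_nz by (simp add: mult_ac)
  moreover have "poly pp (g2 n) / g2 n ^ (2 * N + 1) / ((\<Prod>s'\<in>S - {g2 n}. 1 - g2 n / s') * (\<Prod>r\<in>R. 1 - r / g2 n))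
     = trunc_res (A / b2) (B / b2) (b1 / b2) (C * b2) (D * b2) (b2 * d1) (b2 * d2) N n" if "n \<le> N" for n
    unfolding pp(2)[OF nz'(2)] S(6)[OF that] R(4) trunc_res_def
    unfolding poch_def lessThan_Suc_atMost gdefs
    using nz q_nz by (simp add: mult_ac)
  moreover have "poly pp (h1 n) / h1 n ^ (2 * N + 1) / ((\<Prod>r'\<in>R - {h1 n}. 1 - r' / h1 n) * (\<Prod>s\<in>S. 1 - h1 n / s))
     = trunc_res (D / d1) (C / d1) (d2 / d1) (B * d1) (A * d1) (b1 * d1) (b2 * d1) N n" if "n \<le> N" for n
    unfolding pp(2)[OF nz'(3)] R(5)[OF that] S(4) trunc_res_def
    unfolding poch_def lessThan_Suc_atMost gdefs
    using nz q_nz by (simp add: mult_ac)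
  moreover have "poly pp (h2 n) / h2 n ^ (2 * N + 1) / ((\<Prod>r'\<in>R - {h2 n}. 1 - r' / h2 n) * (\<Prod>s\<in>S. 1 - h2 n / s))
     = trunc_res (D / d2) (C / d2) (d1 / d2) (B * d2) (A * d2) (b1 * d2) (b2 * d2) N n" if "n \<le> N" for n
    unfolding pp(2)[OF nz'(4)] R(6)[OF that] S(4) trunc_res_def
    unfolding poch_def lessThan_Suc_atMost gdefs
    using nz q_nz by (simp add: mult_ac)
  ultimately show ?thesis
    unfolding S(3) R(3) by (simp cong: sum.cong_simp)
qed

section \<open>The limit of the residue sums\<close>

text \<open>
  Tannery's theorem: by \<open>trunc_res_eq\<close> each truncated residue is \<open>(\<alpha>\<beta>/\<gamma>)\<^sup>n\<close> times a product of
  finite q-shifted factorials and inverses of such, all of which are bounded uniformly in \<open>n\<close> and \<open>N\<close>.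
\<close>
lemma trunc_res_sum_tendsto:
  fixes \<alpha> \<beta> \<gamma> c d e f :: complex
  assumes nz: "\<alpha> \<noteq> 0" "\<beta> \<noteq> 0" "\<gamma> \<noteq> 0" and w: "norm (\<alpha> * \<beta> / \<gamma>) < 1"
    and p: "pinf \<gamma> \<noteq> 0" "pinf (q / \<gamma>) \<noteq> 0" "pinf e \<noteq> 0" "pinf f \<noteq> 0"
  defines "L \<equiv> \<lambda>n. (\<alpha> * \<beta> / \<gamma>) ^ n
    * (poch (q / \<alpha>) n * poch (q / \<beta>) n * pinf \<alpha> * pinf \<beta> * pinf (q ^ n * c) * pinf (q ^ n * d))
    / (poch q n * poch (q / \<gamma>) n * pinf q * pinf \<gamma> * pinf (q ^ n * e) * pinf (q ^ n * f))"
  shows "summable L" "(\<lambda>N. \<Sum>n\<le>N. trunc_res \<alpha> \<beta> \<gamma> c d e f N n) \<longlonglongrightarrow> (\<Sum>n. L n)"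
proof -
  define a where "a n N = (if n \<le> N then trunc_res \<alpha> \<beta> \<gamma> c d e f N n else 0)" for n N
  define G where "G n N = (poch (q / \<alpha>) n * poch (q / \<beta>) n * poch \<alpha> (N - n) * poch \<beta> (N - n)
       * poch (q ^ n * c) N * poch (q ^ n * d) N)
    * (inverse (poch q n) * inverse (poch (q / \<gamma>) n) * inverse (poch q (N - n)) * inverse (poch \<gamma> (Suc N - n))
       * inverse (poch (q ^ n * e) (Suc N)) * inverse (poch (q ^ n * f) (Suc N)))" for n N
  have a_eq: "a n N = (\<alpha> * \<beta> / \<gamma>) ^ n * G n N" if "n \<le> N" for n N
    using that nz by (simp add: a_def G_def trunc_res_eq divide_inverse mult_ac)
  \<comment> \<open>uniform boundedness in both indices, a property that passes to products\<close>
  define bnd where "bnd h \<longleftrightarrow> (\<exists>C. \<forall>n N. norm (h n N) \<le> C)" for h :: "nat \<Rightarrow> nat \<Rightarrow> complex"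
  have bnd_mult: "bnd (\<lambda>n N. h n N * k n N)" if h: "bnd h" and k: "bnd k" for h k
  proof -
    obtain C D where "\<And>n N. norm (h n N) \<le> C" "\<And>n N. norm (k n N) \<le> D"
      using h k unfolding bnd_def by blast
    then have "norm (h n N * k n N) \<le> \<bar>C\<bar> * \<bar>D\<bar>" for n N
      unfolding norm_mult by (intro mult_mono) (auto intro: order_trans[OF _ abs_ge_self])
    then show ?thesis
      unfolding bnd_def by blast
  qed
  have bnd_shift: "bnd (\<lambda>n N. poch (q ^ n * u) (k n N))" for u k
    unfolding bnd_def using norm_poch_shift_le by blast
  have bnd_poch: "bnd (\<lambda>n N. poch u (k n N))" for u k
    unfolding bnd_def using norm_poch_shift_le[of 0 u] by auto
  have bnd_inv_shift: "bnd (\<lambda>n N. inverse (poch (q ^ n * u) (k n N)))" if "pinf u \<noteq> 0" for u k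
    using inverse_poch_bounded[OF that] unfolding bnd_def by metis
  have bnd_inv: "bnd (\<lambda>n N. inverse (poch u (k n N)))" if "pinf u \<noteq> 0" for u k
    using inverse_poch_bounded[OF that] unfolding bnd_def by (metis mult_1 power_0)
  have "bnd G"
    unfolding G_def by (intro bnd_mult bnd_shift bnd_poch bnd_inv_shift bnd_inv p pinf_q_nonzero)
  then obtain C where C: "\<And>n N. norm (G n N) \<le> C"
    unfolding bnd_def by blast
  have lim: "(\<lambda>N. a n N) \<longlonglongrightarrow> L n" for n
  proof -
    have shift: "(\<lambda>N. poch u (N - n)) \<longlonglongrightarrow> pinf u" "(\<lambda>N. poch u (Suc N - n)) \<longlonglongrightarrow> pinf u"
      "(\<lambda>N. poch u (Suc N)) \<longlonglongrightarrow> pinf u" for u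
    proof -
      show *: "(\<lambda>N. poch u (N - n)) \<longlonglongrightarrow> pinf u"
        by (rule LIMSEQ_offset[of _ n]) (simp add: poch_tendsto)
      show "(\<lambda>N. poch u (Suc N - n)) \<longlonglongrightarrow> pinf u" "(\<lambda>N. poch u (Suc N)) \<longlonglongrightarrow> pinf u"
        using LIMSEQ_Suc[OF *] LIMSEQ_Suc[OF poch_tendsto] by auto
    qed
    have nz': "pinf (q ^ n * e) \<noteq> 0" "pinf (q ^ n * f) \<noteq> 0"
      using p pinf_split[of e n] pinf_split[of f n] by auto
    have "(\<lambda>N. (\<alpha> * \<beta> / \<gamma>) ^ n * G n N) \<longlonglongrightarrow> (\<alpha> * \<beta> / \<gamma>) ^ n
      * ((poch (q / \<alpha>) n * poch (q / \<beta>) n * pinf \<alpha> * pinf \<beta> * pinf (q ^ n * c) * pinf (q ^ n * d))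
      * (inverse (poch q n) * inverse (poch (q / \<gamma>) n) * inverse (pinf q) * inverse (pinf \<gamma>)
         * inverse (pinf (q ^ n * e)) * inverse (pinf (q ^ n * f))))"
      unfolding G_def by (intro tendsto_intros poch_tendsto shift p pinf_q_nonzero nz')
    moreover have "(\<alpha> * \<beta> / \<gamma>) ^ n
      * ((poch (q / \<alpha>) n * poch (q / \<beta>) n * pinf \<alpha> * pinf \<beta> * pinf (q ^ n * c) * pinf (q ^ n * d))
      * (inverse (poch q n) * inverse (poch (q / \<gamma>) n) * inverse (pinf q) * inverse (pinf \<gamma>)
         * inverse (pinf (q ^ n * e)) * inverse (pinf (q ^ n * f)))) = L n"
      by (simp add: L_def divide_inverse mult_ac)
    ultimately have "(\<lambda>N. (\<alpha> * \<beta> / \<gamma>) ^ n * G n N) \<longlonglongrightarrow> L n"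
      by simp
    then show ?thesis
      by (rule Lim_transform_eventually)
        (use a_eq in \<open>auto intro!: eventually_mono[OF eventually_ge_at_top[of n]]\<close>)
  qed
  have bound: "norm (a n N) \<le> norm (\<alpha> * \<beta> / \<gamma>) ^ n * C" for n N
  proof (cases "n \<le> N")
    case True
    then show ?thesis
      unfolding a_eq[OF True] norm_mult norm_power by (intro mult_left_mono C) auto
  next
    case False
    have "0 \<le> C"
      using C[of 0 0] norm_ge_zero order_trans by blast
    with False show ?thesis
      by (simp add: a_def)
  qed
  have M: "summable (\<lambda>n. norm (\<alpha> * \<beta> / \<gamma>) ^ n * C)"
    using w by (intro summable_mult2 summable_geometric) auto
  have tann: "summable (\<lambda>n. norm (L n))" "(\<lambda>N. \<Sum>n. a n N) \<longlonglongrightarrow> (\<Sum>n. L n)"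
    using tannerys_theorem[OF lim always_eventually M sequentially_bot] bound by auto
  show "summable L"
    using tann(1) by (rule summable_norm_cancel)
  have "(\<Sum>n. a n N) = (\<Sum>n\<le>N. trunc_res \<alpha> \<beta> \<gamma> c d e f N n)" for N
    by (subst suminf_finite[of "{..N}"]) (auto simp: a_def intro!: sum.cong)
  then show "(\<lambda>N. \<Sum>n\<le>N. trunc_res \<alpha> \<beta> \<gamma> c d e f N n) \<longlonglongrightarrow> (\<Sum>n. L n)"
    using tann(2) by simp
qed

text \<open>
  The common shape of the six solutions. Where no denominator vanishes it is
  \<open>\<Sum>\<^sub>n z\<^sup>n \<Prod>\<^sub>j (q\<^sup>n\<^sup>+\<^sup>1 b/b\<^sub>j; q)\<^sub>\<infinity> / \<Prod>\<^sub>i (q\<^sup>n b c\<^sub>i; q)\<^sub>\<infinity>\<close> with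
  \<open>(b\<^sub>1, b\<^sub>2, b\<^sub>3) = (b, b', b'')\<close> and \<open>(c\<^sub>1, c\<^sub>2, c\<^sub>3) = (c, c', c'')\<close>, hence symmetric in \<open>b', b''\<close> and in \<open>c, c', c''\<close>.
\<close>
definition nphi :: "complex \<Rightarrow> complex \<Rightarrow> complex \<Rightarrow> complex \<Rightarrow> complex \<Rightarrow> complex \<Rightarrow> complex \<Rightarrow> complex" where
  "nphi b b' b'' c c' c'' z =
     pinf q * pinf (q * b / b') * pinf (q * b / b'') / (pinf (b * c) * pinf (b * c') * pinf (b * c''))
     * phi32 q (b * c) (b * c') (b * c'') (q * b / b') (q * b / b'') z"

lemma phi32_eq: "phi32 q a1 a2 a3 b1 b2 z
    = (\<Sum>n. poch a1 n * poch a2 n * poch a3 n / (poch q n * poch b1 n * poch b2 n) * z ^ n)"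
  by (simp add: phi32_def qpoch_def poch_def mult.assoc)

lemma nphi_commute:
  "nphi b b' b'' c c' c'' z = nphi b b'' b' c c' c'' z"
  "nphi b b' b'' c c' c'' z = nphi b b' b'' c' c c'' z"
  "nphi b b' b'' c c' c'' z = nphi b b' b'' c c'' c' z"
  by (simp_all add: nphi_def phi32_eq mult_ac)

text \<open>
  The products in \<open>B t\<close> and \<open>C/t\<close> will come from one theta function, which means \<open>B C = q\<close>, or
  \<open>c = q / \<beta>\<close> in terms of the parameters of \<open>trunc_res\<close>. This cancels one q-shifted factorial
  against an infinite product and turns the limiting sum into a \<open>\<^sub>3\<phi>\<^sub>2\<close> series. The remaining
  constants combine into theta functions.
\<close>
lemma trunc_res_sum_tendsto_nphi:
  assumes nz: "b \<noteq> 0" "b' \<noteq> 0" "b'' \<noteq> 0" "c \<noteq> 0" "c' \<noteq> 0" "c'' \<noteq> 0" "\<beta> \<noteq> 0"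
    and w: "norm (q * \<beta> / (b' * c'')) < 1"
    and th: "theta q (b' / b) \<noteq> 0"
    and p: "pinf (b * c) \<noteq> 0" "pinf (b * c') \<noteq> 0" "pinf (b * c'') \<noteq> 0" "pinf (q * b / b'') \<noteq> 0"
  shows "(\<lambda>N. \<Sum>n\<le>N. trunc_res (q / (b * c'')) \<beta> (b' / b) (q / \<beta>) (q * b / b'') (b * c) (b * c') N n)
    \<longlonglongrightarrow> theta q (b * c'') * theta q \<beta> / (theta q (b' / b) * pinf q ^ 3)
        * nphi b b' b'' c c' c'' (q * \<beta> / (b' * c''))"
proof -
  define \<alpha> where "\<alpha> = q / (b * c'')"
  define \<gamma> where "\<gamma> = b' / b"
  define d where "d = q * b / b''"
  define K where "K = pinf \<alpha> * pinf \<beta> * pinf (q / \<beta>) * pinf d / (pinf q * pinf \<gamma> * pinf (b * c) * pinf (b * c'))"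
  define z where "z = q * \<beta> / (b' * c'')"
  have z: "\<alpha> * \<beta> / \<gamma> = z"
    using nz by (simp add: \<alpha>_def \<gamma>_def z_def field_simps)
  have q\<alpha>: "q / \<alpha> = b * c''" and q\<gamma>: "q / \<gamma> = q * b / b'"
    using nz q_nz by (simp_all add: \<alpha>_def \<gamma>_def)
  have \<gamma>: "pinf \<gamma> \<noteq> 0" "pinf (q / \<gamma>) \<noteq> 0"
    using theta_nonzeroD[OF th] by (simp_all add: \<gamma>_def)
  have *: "\<alpha> \<noteq> 0" "\<beta> \<noteq> 0" "\<gamma> \<noteq> 0"
    using nz q_nz by (auto simp: \<alpha>_def \<gamma>_def)
  note L = trunc_res_sum_tendsto[OF * w[folded z_def, folded z] \<gamma> p(1,2), where c = "q / \<beta>" and d = d]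
  define T where "T n = poch (b * c) n * poch (b * c') n * poch (b * c'') n / (poch q n * poch (q * b / b') n * poch d n) * z ^ n" for n
  have LT: "(\<alpha> * \<beta> / \<gamma>) ^ n
    * (poch (q / \<alpha>) n * poch (q / \<beta>) n * pinf \<alpha> * pinf \<beta> * pinf (q ^ n * (q / \<beta>)) * pinf (q ^ n * d))
    / (poch q n * poch (q / \<gamma>) n * pinf q * pinf \<gamma> * pinf (q ^ n * (b * c)) * pinf (q ^ n * (b * c')))
    = K * T n" for n
  proof -
    have "pinf (q ^ n * d) = pinf d / poch d n"
      using pinf_split[of d n] pinf_nonzeroD[OF p(4), of n] by (simp add: d_def)
    moreover have "pinf (q ^ n * (b * c)) = pinf (b * c) / poch (b * c) n" "pinf (q ^ n * (b * c')) = pinf (b * c') / poch (b * c') n"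
      using pinf_split[of "b * c" n] pinf_split[of "b * c'" n] pinf_nonzeroD[OF p(1), of n] pinf_nonzeroD[OF p(2), of n]
      by simp_all
    ultimately show ?thesis
      unfolding z q\<alpha> q\<gamma> T_def K_def pinf_split[of "q / \<beta>" n] by (simp add: mult_ac)
  qed
  have phi: "(\<Sum>n. T n) = phi32 q (b * c) (b * c') (b * c'') (q * b / b') (q * b / b'') z"
    by (simp add: phi32_eq T_def d_def)
  have "(\<Sum>n. K * T n) = K * (\<Sum>n. T n)"
  proof (cases "K = 0")
    case False
    then have "summable T"
      using L(1) unfolding LT by (simp add: summable_cmult_iff)
    then show ?thesis
      by (rule suminf_mult)
  qed simp
  also have "\<dots> = theta q (b * c'') * theta q \<beta> / (theta q (b' / b) * pinf q ^ 3)
        * nphi b b' b'' c c' c'' z"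
    unfolding phi nphi_def K_def using p \<gamma> pinf_q_nonzero
    by (simp add: theta_eq q\<gamma>[unfolded \<gamma>_def] power3_eq_cube flip: \<gamma>_def \<alpha>_def d_def)
      (simp add: q\<gamma> field_simps)
  finally have S: "(\<Sum>n. K * T n) = theta q (b * c'') * theta q \<beta> / (theta q (b' / b) * pinf q ^ 3)
        * nphi b b' b'' c c' c'' z" .
  show ?thesis
    using L(2)[unfolded LT S] unfolding \<alpha>_def \<gamma>_def d_def z_def .
qed

section \<open>The connection formula\<close>

lemma theta_inverse:
  assumes "t \<noteq> 0"
  shows "theta q (1 / t) = - theta q t / t"
  using theta_reflect[of "q * t"] theta_q_mult[OF assms] assms q_nz by simp

lemma theta_reflectI:
  assumes "s * t = q"
  shows "theta q s = theta q t"
proof -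
  have "t \<noteq> 0" "s = q / t"
    using assms q_nz by (auto simp: field_simps)
  then show ?thesis
    by (simp add: theta_reflect)
qed

text \<open>
  The parameters are nonzero, the poles \<open>q\<^sup>-\<^sup>n / b\<^sub>i\<close> stay away from the points \<open>c\<^sub>j q\<^sup>n\<close>, and the
  lower parameters of the six series are no nonpositive powers of \<open>q\<close>. All of this is invariant under
  permutations of the \<open>b\<^sub>i\<close> and of the \<open>c\<^sub>j\<close>.
\<close>
definition nonresonant :: "complex \<Rightarrow> complex \<Rightarrow> complex \<Rightarrow> complex \<Rightarrow> complex \<Rightarrow> complex \<Rightarrow> bool" where
  "nonresonant b1 b2 b3 c1 c2 c3 \<longleftrightarrow>
     b1 \<noteq> 0 \<and> b2 \<noteq> 0 \<and> b3 \<noteq> 0 \<and> c1 \<noteq> 0 \<and> c2 \<noteq> 0 \<and> c3 \<noteq> 0 \<and>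
     pinf (b1 * c1) \<noteq> 0 \<and> pinf (b1 * c2) \<noteq> 0 \<and> pinf (b1 * c3) \<noteq> 0 \<and>
     pinf (b2 * c1) \<noteq> 0 \<and> pinf (b2 * c2) \<noteq> 0 \<and> pinf (b2 * c3) \<noteq> 0 \<and>
     pinf (b3 * c1) \<noteq> 0 \<and> pinf (b3 * c2) \<noteq> 0 \<and> pinf (b3 * c3) \<noteq> 0 \<and>
     pinf (q * b1 / b2) \<noteq> 0 \<and> pinf (q * b1 / b3) \<noteq> 0 \<and> pinf (q * b2 / b1) \<noteq> 0 \<and>
     pinf (q * b2 / b3) \<noteq> 0 \<and> pinf (q * b3 / b1) \<noteq> 0 \<and> pinf (q * b3 / b2) \<noteq> 0 \<and>
     pinf (q * c1 / c2) \<noteq> 0 \<and> pinf (q * c1 / c3) \<noteq> 0 \<and> pinf (q * c2 / c1) \<noteq> 0 \<and>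
     pinf (q * c2 / c3) \<noteq> 0 \<and> pinf (q * c3 / c1) \<noteq> 0 \<and> pinf (q * c3 / c2) \<noteq> 0"

lemma nonresonant_commute:
  "nonresonant b1 b2 b3 c1 c2 c3 \<Longrightarrow> nonresonant b2 b1 b3 c1 c2 c3"
  unfolding nonresonant_def by auto

text \<open>
  The limit of \<open>trunc_res_sum\<close> for \<open>A = q/c3\<close>, \<open>B = u\<close>, \<open>C = q/u\<close>, \<open>D = q/b3\<close>, \<open>d1 = c1\<close>, \<open>d2 = c2\<close> with
  \<open>u = q/(b3 c1 c2)\<close>. This value of \<open>u\<close> is what makes the extra factor elliptic; with it the
  ratios of the limiting series are \<open>z\<close> on the left and \<open>q\<close> on the right, independently of the chosen pair.
\<close>
lemma residue_relation:
  assumes nr: "nonresonant b1 b2 b3 c1 c2 c3"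
    and th: "theta q (b2 / b1) \<noteq> 0" "theta q (c2 / c1) \<noteq> 0"
    and z: "z = q ^ 2 / (b1 * b2 * b3 * c1 * c2 * c3)" "norm z < 1"
  shows "theta q (b1 * c3) * theta q (b1 * b3 * c1 * c2) / theta q (b2 / b1) * nphi b1 b2 b3 c1 c2 c3 z
       + theta q (b2 * c3) * theta q (b2 * b3 * c1 * c2) / theta q (b1 / b2) * nphi b2 b1 b3 c1 c2 c3 z
       = theta q (b3 * c1) * theta q (b3 * c2) / theta q (c2 / c1)
         * (nphi c1 c2 c3 b1 b2 b3 q - c2 / c1 * nphi c2 c1 c3 b1 b2 b3 q)"
proof -
  have nz: "b1 \<noteq> 0" "b2 \<noteq> 0" "b3 \<noteq> 0" "c1 \<noteq> 0" "c2 \<noteq> 0" "c3 \<noteq> 0"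
    and p: "pinf (b1 * c1) \<noteq> 0" "pinf (b1 * c2) \<noteq> 0" "pinf (b1 * c3) \<noteq> 0"
     "pinf (b2 * c1) \<noteq> 0" "pinf (b2 * c2) \<noteq> 0" "pinf (b2 * c3) \<noteq> 0"
     "pinf (b3 * c1) \<noteq> 0" "pinf (b3 * c2) \<noteq> 0"
    and p': "pinf (q * b1 / b3) \<noteq> 0" "pinf (q * b2 / b3) \<noteq> 0"
     "pinf (q * c1 / c3) \<noteq> 0" "pinf (q * c2 / c3) \<noteq> 0"
    using nr unfolding nonresonant_def by auto
  have p_rev: "pinf (c1 * b1) \<noteq> 0" "pinf (c1 * b2) \<noteq> 0" "pinf (c1 * b3) \<noteq> 0"
     "pinf (c2 * b1) \<noteq> 0" "pinf (c2 * b2) \<noteq> 0" "pinf (c2 * b3) \<noteq> 0"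
    using p by (simp_all add: mult.commute)
  have inv: "theta q (b1 / b2) = - theta q (b2 / b1) / (b2 / b1)" "theta q (c1 / c2) = - theta q (c2 / c1) / (c2 / c1)"
    using theta_inverse[of "b2 / b1"] theta_inverse[of "c2 / c1"] nz by simp_all
  then have th': "theta q (b1 / b2) \<noteq> 0" "theta q (c1 / c2) \<noteq> 0"
    using th nz by auto
  define u where "u = q / (c1 * c2 * b3)"
  have u: "u \<noteq> 0"
    using nz q_nz by (simp add: u_def)
  have zu: "q * (u / b1) / (b2 * c3) = z" "q * (u / b2) / (b1 * c3) = z"
    by (simp_all add: z u_def power2_eq_square mult_ac)
  have zq: "q * (b3 * c2) / (c2 * b3) = q" "q * (b3 * c1) / (c1 * b3) = q"
    using nz by simp_all
  note l1 = trunc_res_sum_tendsto_nphi[OF nz(1,2,3,4,5,6) _ _ th(1) p(1,2,3) p'(1), of "u / b1", unfolded zu]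
  note l2 = trunc_res_sum_tendsto_nphi[OF nz(2,1,3,4,5,6) _ _ th'(1) p(4,5,6) p'(2), of "u / b2", unfolded zu]
  note l3 = trunc_res_sum_tendsto_nphi[OF nz(4,5,6,1,2,3) _ _ th(2) p_rev(1,2,3) p'(3), of "b3 * c2", unfolded zq]
  note l4 = trunc_res_sum_tendsto_nphi[OF nz(5,4,6,1,2,3) _ _ th'(2) p_rev(4,5,6) p'(4), of "b3 * c1", unfolded zq]
  define K where "K = pinf q ^ 3"
  have K: "K \<noteq> 0"
    using pinf_q_nonzero by (simp add: K_def)
  have fin: "(\<Sum>n\<le>N. trunc_res (q / (b1 * c3)) (u / b1) (b2 / b1) (q / (u / b1)) (q * b1 / b3) (b1 * c1) (b1 * c2) N n)
     + (\<Sum>n\<le>N. trunc_res (q / (b2 * c3)) (u / b2) (b1 / b2) (q / (u / b2)) (q * b2 / b3) (b2 * c1) (b2 * c2) N n)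
     = (\<Sum>n\<le>N. trunc_res (q / (c1 * b3)) (b3 * c2) (c2 / c1) (q / (b3 * c2)) (q * c1 / c3) (c1 * b1) (c1 * b2) N n)
     + (\<Sum>n\<le>N. trunc_res (q / (c2 * b3)) (b3 * c1) (c1 / c2) (q / (b3 * c1)) (q * c2 / c3) (c2 * b1) (c2 * b2) N n)" for N
  proof -
    have e: "q / c3 / b = q / (b * c3)" "q / u * b = q / (u / b)" "q / b3 * b = q * b / b3"
      "q / b3 / c = q / (c * b3)" "q / c3 * c = q * c / c3" for b c
      using nz by (simp_all add: mult_ac)
    have e': "q / u / c1 = b3 * c2" "q / u / c2 = b3 * c1" "u * c1 = q / (b3 * c2)" "u * c2 = q / (b3 * c1)"
      using nz q_nz by (simp_all add: u_def field_simps)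
    have s: "b1 * c1 = c1 * b1" "b2 * c1 = c1 * b2" "b1 * c2 = c2 * b1" "b2 * c2 = c2 * b2"
      by (simp_all add: mult.commute)
    show ?thesis
      using trunc_res_sum[OF nz(1,2,4,5) th p(1,2,4,5), where A = "q / c3" and B = u and C = "q / u" and D = "q / b3" and N = N]
      unfolding e e' unfolding s .
  qed
  have "theta q (b1 * c3) * theta q (u / b1) / (theta q (b2 / b1) * K) * nphi b1 b2 b3 c1 c2 c3 z
      + theta q (b2 * c3) * theta q (u / b2) / (theta q (b1 / b2) * K) * nphi b2 b1 b3 c1 c2 c3 z
      = theta q (c1 * b3) * theta q (b3 * c2) / (theta q (c2 / c1) * K) * nphi c1 c2 c3 b1 b2 b3 q
      + theta q (c2 * b3) * theta q (b3 * c1) / (theta q (c1 / c2) * K) * nphi c2 c1 c3 b1 b2 b3 q"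
  proof (rule LIMSEQ_unique)
    show "(\<lambda>N. (\<Sum>n\<le>N. trunc_res (q / (b1 * c3)) (u / b1) (b2 / b1) (q / (u / b1)) (q * b1 / b3) (b1 * c1) (b1 * c2) N n)
     + (\<Sum>n\<le>N. trunc_res (q / (b2 * c3)) (u / b2) (b1 / b2) (q / (u / b2)) (q * b2 / b3) (b2 * c1) (b2 * c2) N n))
      \<longlonglongrightarrow> theta q (b1 * c3) * theta q (u / b1) / (theta q (b2 / b1) * K) * nphi b1 b2 b3 c1 c2 c3 z
      + theta q (b2 * c3) * theta q (u / b2) / (theta q (b1 / b2) * K) * nphi b2 b1 b3 c1 c2 c3 z"
      unfolding K_def using u nz z(2) by (intro tendsto_add l1 l2) auto
    show "(\<lambda>N. (\<Sum>n\<le>N. trunc_res (q / (b1 * c3)) (u / b1) (b2 / b1) (q / (u / b1)) (q * b1 / b3) (b1 * c1) (b1 * c2) N n)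
     + (\<Sum>n\<le>N. trunc_res (q / (b2 * c3)) (u / b2) (b1 / b2) (q / (u / b2)) (q * b2 / b3) (b2 * c1) (b2 * c2) N n))
      \<longlonglongrightarrow> theta q (c1 * b3) * theta q (b3 * c2) / (theta q (c2 / c1) * K) * nphi c1 c2 c3 b1 b2 b3 q
      + theta q (c2 * b3) * theta q (b3 * c1) / (theta q (c1 / c2) * K) * nphi c2 c1 c3 b1 b2 b3 q"
      unfolding fin K_def using nz q_lt by (intro tendsto_add l3 l4) auto
  qed
  moreover have "theta q (u / b1) = theta q (b1 * b3 * c1 * c2)" "theta q (u / b2) = theta q (b2 * b3 * c1 * c2)"
    using nz by (auto intro!: theta_reflectI simp: u_def)
  ultimately have main: "(theta q (b1 * c3) * theta q (b1 * b3 * c1 * c2) / theta q (b2 / b1) * nphi b1 b2 b3 c1 c2 c3 z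
      + theta q (b2 * c3) * theta q (b2 * b3 * c1 * c2) / theta q (b1 / b2) * nphi b2 b1 b3 c1 c2 c3 z) / K
      = (theta q (b3 * c1) * theta q (b3 * c2) / theta q (c2 / c1) * nphi c1 c2 c3 b1 b2 b3 q
      + theta q (b3 * c2) * theta q (b3 * c1) / theta q (c1 / c2) * nphi c2 c1 c3 b1 b2 b3 q) / K"
    by (simp add: add_divide_distrib mult.commute[of c1 b3] mult.commute[of c2 b3])
  moreover have "theta q (b3 * c2) * theta q (b3 * c1) / theta q (c1 / c2) * nphi c2 c1 c3 b1 b2 b3 q
      = - (theta q (b3 * c1) * theta q (b3 * c2) / theta q (c2 / c1) * (c2 / c1 * nphi c2 c1 c3 b1 b2 b3 q))"
    unfolding inv by (simp add: mult_ac)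
  ultimately show ?thesis
    using K by (simp add: right_diff_distrib)
qed

text \<open>
  The quotient of \<open>\<theta>(b2/b1)\<close> and \<open>\<theta>(b1/b2)\<close> is elementary, but is kept because the coefficients of
  the relations contain both theta functions.
\<close>
lemma connection_formula:
  assumes nr: "nonresonant b1 b2 b3 c1 c2 c3"
    and th: "theta q (b1 / b2) \<noteq> 0" "theta q (c2 / c1) \<noteq> 0" "theta q (b1 * c3) \<noteq> 0" "theta q (b1 * b3 * c1 * c2) \<noteq> 0"
    and z: "z = q ^ 2 / (b1 * b2 * b3 * c1 * c2 * c3)" "norm z < 1"
  shows "nphi b1 b2 b3 c1 c2 c3 z =
      theta q (b2 / b1) * theta q (b3 * c1) * theta q (b3 * c2)
        / (theta q (b1 * c3) * theta q (b1 * b3 * c1 * c2) * theta q (c2 / c1))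
        * (nphi c1 c2 c3 b1 b2 b3 q - c2 / c1 * nphi c2 c1 c3 b1 b2 b3 q)
    - theta q (b2 / b1) * theta q (b2 * c3) * theta q (b2 * b3 * c1 * c2)
        / (theta q (b1 / b2) * theta q (b1 * c3) * theta q (b1 * b3 * c1 * c2))
        * nphi b2 b1 b3 c1 c2 c3 z"
proof -
  have "b1 \<noteq> 0" "b2 \<noteq> 0"
    using nr by (auto simp: nonresonant_def)
  then have th': "theta q (b2 / b1) \<noteq> 0"
    using theta_inverse[of "b1 / b2"] th(1) by simp
  have alg: "X1 = t * t1 * t2 / (s1 * s2 * s3) * Y - t * r1 * r2 / (r3 * s1 * s2) * X2"
    if "s1 * s2 / t * X1 + r1 * r2 / r3 * X2 = t1 * t2 / s3 * Y" "t \<noteq> 0" "s1 \<noteq> 0" "s2 \<noteq> 0" "s3 \<noteq> 0" "r3 \<noteq> 0"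
    for X1 X2 Y t t1 t2 s1 s2 s3 r1 r2 r3 :: complex
  proof -
    have "X1 = t / (s1 * s2) * (s1 * s2 / t * X1)"
      using that by simp
    also have "s1 * s2 / t * X1 = t1 * t2 / s3 * Y - r1 * r2 / r3 * X2"
      using that(1) by (simp add: algebra_simps)
    finally show ?thesis
      by (simp add: algebra_simps)
  qed
  show ?thesis
    by (rule alg[OF residue_relation[OF nr th' th(2) z]]) (use th th' in auto)
qed

end

section \<open>The six solutions and their relations\<close>

locale jackson_data = q_disc +
  fixes lq \<alpha>1 \<alpha>2 lam mu :: complex and lx :: "complex \<Rightarrow> complex" and x :: complex
  assumes exp_lq: "exp lq = q"
    and nz: "\<alpha>1 \<noteq> 0" "\<alpha>2 \<noteq> 0" "x \<noteq> 0"
begin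

text \<open>The value of \<open>q\<^sup>\<lambda>\<close> for the chosen logarithm of \<open>q\<close>.\<close>
abbreviation E :: complex where "E \<equiv> exp (lam * lq)"

lemma exp_shifts:
  "exp ((lam + 1) * lq) = E * q" "exp ((lam + 2) * lq) = E * q ^ 2"
  "exp ((- lam) * lq) = 1 / E" "exp ((- lam + 1) * lq) = q / E"
  "exp ((lam - 1) * lq) = E / q" "exp ((- lam - 1) * lq) = 1 / (E * q)"
proof -
  have "exp ((lam + 2) * lq) = exp (lam * lq) * (exp lq * exp lq)"
    by (simp add: ring_distribs flip: exp_add)
  then show "exp ((lam + 2) * lq) = E * q ^ 2"
    by (simp add: exp_lq power2_eq_square)
  have *: "exp ((- lam) * lq) = 1 / E"
    by (simp add: exp_minus divide_inverse)
  then show "exp ((- lam) * lq) = 1 / E" .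
  have "exp ((- lam + 1) * lq) = exp ((- lam) * lq) * exp lq" "exp ((- lam - 1) * lq) = exp ((- lam) * lq) / exp lq"
    by (simp_all add: ring_distribs flip: exp_add exp_diff)
  then show "exp ((- lam + 1) * lq) = q / E" "exp ((- lam - 1) * lq) = 1 / (E * q)"
    by (simp_all add: exp_lq exp_minus divide_inverse)
  show "exp ((lam + 1) * lq) = E * q" "exp ((lam - 1) * lq) = E / q"
    by (simp_all add: ring_distribs exp_add exp_diff exp_lq)
qed

lemma qpoch_inf_eq: "qpoch_inf q [a, b, c] = pinf a * pinf b * pinf c"
  by (simp add: qpoch_inf_def pinf_def mult.assoc)

abbreviation Xser :: "complex \<Rightarrow> complex \<Rightarrow> complex \<Rightarrow> complex \<Rightarrow> complex" where
  "Xser z b b' b'' \<equiv> nphi b b' b'' (1 / \<alpha>1) (q / \<alpha>2) (x / E) z"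

abbreviation Yser :: "complex \<Rightarrow> complex \<Rightarrow> complex \<Rightarrow> complex \<Rightarrow> complex \<Rightarrow> complex" where
  "Yser c c' c'' b b' \<equiv> nphi c c' c'' b b' (q / x) q"

text \<open>
  The arguments of the theta functions that \<open>connection_formula\<close> produces for the various choices of
  pairs, brought to the form that they have in the coefficients: here those that need the reflection
  \<open>t \<mapsto> q/t\<close>, later (\<open>theta_equal_args\<close>) those that agree as they stand.
\<close>
lemma theta_reflected_args:
  assumes "b \<noteq> 0"
  shows "theta q ((q / x) / b) = theta q (b * x)"
    "theta q (b * (q / \<alpha>2)) = theta q (\<alpha>2 / b)"
    "theta q ((q / x) * (1 / \<alpha>1)) = theta q (\<alpha>1 * x)"
    "theta q ((q / x) * (q / \<alpha>2)) = theta q (\<alpha>2 * x / q)"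
    "theta q ((q / x) * (x / E)) = theta q E"
    "theta q ((q / \<alpha>2) / (1 / \<alpha>1)) = theta q (\<alpha>2 / \<alpha>1)"
    "theta q ((q / x) * b * (1 / \<alpha>1) * (q / \<alpha>2)) = theta q (\<alpha>1 * \<alpha>2 * x / (q * b))"
    "theta q (b * (q / x) * (1 / \<alpha>1) * (q / \<alpha>2)) = theta q (\<alpha>1 * \<alpha>2 * x / (q * b))"
    "theta q ((q / x) * b * (q / \<alpha>2) * (x / E)) = theta q (E / q * \<alpha>2 / b)"
    "theta q (b * (q / x) * (q / \<alpha>2) * (x / E)) = theta q (E / q * \<alpha>2 / b)"
    "theta q ((q / x) * b * (1 / \<alpha>1) * (x / E)) = theta q (E * \<alpha>1 / b)"
    "theta q (b * (q / x) * (1 / \<alpha>1) * (x / E)) = theta q (E * \<alpha>1 / b)"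
  using assms nz q_nz by (auto intro!: theta_reflectI simp: field_simps power2_eq_square)

lemma theta_reflected_arg2:
  assumes "b \<noteq> 0" "b' \<noteq> 0"
  shows "theta q (b * b' * (1 / \<alpha>1) * (q / \<alpha>2)) = theta q (\<alpha>1 * \<alpha>2 / (b * b'))"
  using assms nz q_nz by (auto intro!: theta_reflectI simp: field_simps power2_eq_square)

context
  fixes b b' l l' :: complex
  assumes b: "b \<noteq> 0" "b' \<noteq> 0"
begin

abbreviation P :: params where
  "P \<equiv> Params q lq \<alpha>1 \<alpha>2 b b' l l' lam mu lx"

lemma y_alpha1_eq: "y_alpha1 P x
    = (q - 1) * Yser (1 / \<alpha>1) (q / \<alpha>2) (x / E) b b'"
  unfolding y_alpha1.simps exp_shifts qpoch_inf_eq nphi_def phi32_eq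
  using b nz q_nz by (simp add: mult_ac)

lemma y_alpha2_eq: "y_alpha2 P x
    = (q - 1) * (q * \<alpha>1 / \<alpha>2) * Yser (q / \<alpha>2) (1 / \<alpha>1) (x / E) b b'"
  unfolding y_alpha2.simps exp_shifts qpoch_inf_eq nphi_def phi32_eq
  using b nz q_nz by (simp add: mult_ac power2_eq_square)

lemma y_lambda_eq: "y_lambda P x
    = (q - 1) * (\<alpha>1 * x / E) * Yser (x / E) (1 / \<alpha>1) (q / \<alpha>2) b b'"
  unfolding y_lambda.simps exp_shifts qpoch_inf_eq nphi_def phi32_eq
  using b nz q_nz by (simp add: mult_ac)

lemma y_beta1_eq: "y_beta1 P x
    = (1 - q) * exp ((lam - mu) * l) * exp (lam * lx x) * Xser (E * \<alpha>1 * \<alpha>2 / (b * b')) b b' (q / x)"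
  unfolding y_beta1.simps exp_shifts qpoch_inf_eq nphi_def phi32_eq
  using b nz q_nz by (simp add: mult_ac)

lemma y_beta2_eq: "y_beta2 P x
    = (1 - q) * exp ((lam - mu) * l') * exp (lam * lx x) * Xser (E * \<alpha>1 * \<alpha>2 / (b * b')) b' b (q / x)"
  unfolding y_beta2.simps exp_shifts qpoch_inf_eq nphi_def phi32_eq
  using b nz q_nz by (simp add: mult_ac)

lemma y_x_eq: "y_x P x
    = (1 - q) * exp ((lam - mu) * lq) * exp (mu * lx x) * Xser (E * \<alpha>1 * \<alpha>2 / (b * b')) (q / x) b b'"
  unfolding y_x.simps exp_shifts qpoch_inf_eq nphi_def phi32_eq
  using b nz q_nz by (simp add: mult_ac power2_eq_square)

text \<open>
  How the elementary factors of the solutions enter the coefficients: \<open>w\<close> and \<open>w'\<close> are those of the two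
  residue sums, while \<open>s\<close> and \<open>s * r\<close> are those of the two Jackson integrals, whose quotient \<open>r\<close> is the
  one occurring in \<open>connection_formula\<close>.
\<close>
lemma relation_of_connection:
  fixes X1 X2 Y1 Y2 k k' r s w w' j j' :: complex
  assumes "X1 = k * (Y1 - r * Y2) - k' * X2"
    and "y1 = (1 - q) * w * X1" "y2 = (1 - q) * w' * X2"
    and "ya = (q - 1) * s * Y1" "yb = (q - 1) * (s * r) * Y2"
    and "j * s = - (w * k)" "j' * w' = - (w * k')"
  shows "y1 = j * (ya - yb) + j' * y2"
proof -
  have "j * (ya - yb) + j' * y2 = (q - 1) * (j * s) * (Y1 - r * Y2) + (1 - q) * (j' * w') * X2"
    by (simp add: assms(3-5) algebra_simps)
  also have "\<dots> = y1"
    unfolding assms(6,7,2,1) by (simp add: algebra_simps)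
  finally show ?thesis by simp
qed

text \<open>
  The parameters are kept fixed here: with a variable in place of \<open>b\<close> some of these equations would also
  apply to products that have to be reflected.
\<close>
lemma theta_equal_args:
  shows "theta q (b / (q / x)) = theta q (b * x / q)"
    "theta q (b * (1 / \<alpha>1)) = theta q (b / \<alpha>1)"
    "theta q (b' * (1 / \<alpha>1)) = theta q (b' / \<alpha>1)"
    "theta q (b * (x / E)) = theta q (1 / E * b * x)"
    "theta q (b' * (x / E)) = theta q (1 / E * b' * x)"
    "theta q ((x / E) / (1 / \<alpha>1)) = theta q (1 / E * \<alpha>1 * x)"
    "theta q ((x / E) / (q / \<alpha>2)) = theta q (1 / (E * q) * \<alpha>2 * x)"
    "theta q (b * b' * (q / \<alpha>2) * (x / E)) = theta q (q / E * b * b' * x / \<alpha>2)"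
    "theta q (b * b' * (1 / \<alpha>1) * (x / E)) = theta q (1 / E * b * b' * x / \<alpha>1)"
  by (simp_all add: mult_ac)

lemmas th = theta_reflected_args[OF b(1)] theta_reflected_args[OF b(2)] theta_reflected_arg2[OF b] theta_equal_args
lemmas ys = y_alpha1_eq y_alpha2_eq y_lambda_eq y_beta1_eq y_beta2_eq y_x_eq

lemma exp_mu:
  "exp ((- lam + mu) * t) = 1 / exp ((lam - mu) * t)"
  "exp (lam * lx x) = exp ((lam - mu) * lx x) * exp (mu * lx x)"
proof -
  have "exp ((- lam + mu) * t) * exp ((lam - mu) * t) = 1"
    unfolding exp_add[symmetric] by (simp add: algebra_simps)
  then show "exp ((- lam + mu) * t) = 1 / exp ((lam - mu) * t)"
    by (simp add: field_simps)
  show "exp (lam * lx x) = exp ((lam - mu) * lx x) * exp (mu * lx x)"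
    unfolding exp_add[symmetric] by (simp add: algebra_simps)
qed

context
  assumes nr: "nonresonant b b' (q / x) (1 / \<alpha>1) (q / \<alpha>2) (x / E)"
    and conv: "norm (E * \<alpha>1 * \<alpha>2 / (b * b')) < 1"
begin

text \<open>
  The relation with the coefficients \<open>J11, J13\<close> uses the pair \<open>b, q/x\<close> of poles and the pair
  \<open>1/\<alpha>1, q/\<alpha>2\<close> of end points. The odd-numbered relations eliminate \<open>b'\<close>, the
  even-numbered ones \<open>q/x\<close>; in the order of numbering, the omitted end point is \<open>x/E\<close> in the first two,
  \<open>1/\<alpha>1\<close> in the next two and \<open>q/\<alpha>2\<close> in the last two.
\<close>
lemma relation_J1:
  assumes "theta q (b * x / q) \<noteq> 0" "theta q (\<alpha>2 / \<alpha>1) \<noteq> 0"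
    "theta q (exp ((- lam) * lq) * b * x) \<noteq> 0" "theta q (\<alpha>1 * \<alpha>2 / (b * b')) \<noteq> 0"
  shows "y_beta1 P x = J11 P x * (y_alpha1 P x - y_alpha2 P x) + J13 P x * y_x P x"
proof (rule relation_of_connection[OF connection_formula[of b "q / x" "b'" "1 / \<alpha>1" "q / \<alpha>2" "x / E"
        "E * \<alpha>1 * \<alpha>2 / (b * b')"] _ _ _ _ _ _,
      where w = "exp ((lam - mu) * l) * exp (lam * lx x)"
        and w' = "exp ((lam - mu) * lq) * exp (mu * lx x)" and s = "1"])
  show "nonresonant b (q / x) b' (1 / \<alpha>1) (q / \<alpha>2) (x / E)"
    using nr by (auto simp: nonresonant_def mult.commute)
qed (unfold th ys J11.simps J13.simps exp_shifts exp_mu, insert assms[unfolded exp_shifts] conv,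
  use nz q_nz b in \<open>simp_all add: nphi_commute power2_eq_square mult_ac\<close>)

lemma relation_J2:
  assumes "theta q (b / b') \<noteq> 0" "theta q (\<alpha>2 / \<alpha>1) \<noteq> 0"
    "theta q (exp ((- lam) * lq) * b * x) \<noteq> 0" "theta q (\<alpha>1 * \<alpha>2 * x / (q * b)) \<noteq> 0"
  shows "y_beta1 P x = J21 P x * (y_alpha1 P x - y_alpha2 P x) + J23 P x * y_beta2 P x"
proof (rule relation_of_connection[OF connection_formula[of b "b'" "q / x" "1 / \<alpha>1" "q / \<alpha>2" "x / E"
        "E * \<alpha>1 * \<alpha>2 / (b * b')"] _ _ _ _ _ _,
      where w = "exp ((lam - mu) * l) * exp (lam * lx x)"
        and w' = "exp ((lam - mu) * l') * exp (lam * lx x)" and s = "1"])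
  show "nonresonant b b' (q / x) (1 / \<alpha>1) (q / \<alpha>2) (x / E)"
    using nr by (auto simp: nonresonant_def mult.commute)
qed (unfold th ys J21.simps J23.simps exp_shifts exp_mu, insert assms[unfolded exp_shifts] conv,
  use nz q_nz b in \<open>simp_all add: nphi_commute power2_eq_square mult_ac\<close>)

lemma relation_J3:
  assumes "theta q (b * x / q) \<noteq> 0" "theta q (exp ((- lam - 1) * lq) * \<alpha>2 * x) \<noteq> 0"
    "theta q (b / \<alpha>1) \<noteq> 0" "theta q (exp ((- lam + 1) * lq) * b * b' * x / \<alpha>2) \<noteq> 0"
  shows "y_beta1 P x = J31 P x * (y_alpha2 P x - y_lambda P x) + J33 P x * y_x P x"
proof (rule relation_of_connection[OF connection_formula[of b "q / x" "b'" "q / \<alpha>2" "x / E" "1 / \<alpha>1"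
        "E * \<alpha>1 * \<alpha>2 / (b * b')"] _ _ _ _ _ _,
      where w = "exp ((lam - mu) * l) * exp (lam * lx x)"
        and w' = "exp ((lam - mu) * lq) * exp (mu * lx x)" and s = "q * \<alpha>1 / \<alpha>2"])
  show "nonresonant b (q / x) b' (q / \<alpha>2) (x / E) (1 / \<alpha>1)"
    using nr by (auto simp: nonresonant_def mult.commute)
qed (unfold th ys J31.simps J33.simps exp_shifts exp_mu, insert assms[unfolded exp_shifts] conv,
  use nz q_nz b in \<open>simp_all add: nphi_commute power2_eq_square mult_ac\<close>)

lemma relation_J4:
  assumes "theta q (b / b') \<noteq> 0" "theta q (exp ((- lam - 1) * lq) * \<alpha>2 * x) \<noteq> 0"
    "theta q (b / \<alpha>1) \<noteq> 0" "theta q (exp ((lam - 1) * lq) * \<alpha>2 / b) \<noteq> 0"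
  shows "y_beta1 P x = J41 P x * (y_alpha2 P x - y_lambda P x) + J43 P x * y_beta2 P x"
proof (rule relation_of_connection[OF connection_formula[of b "b'" "q / x" "q / \<alpha>2" "x / E" "1 / \<alpha>1"
        "E * \<alpha>1 * \<alpha>2 / (b * b')"] _ _ _ _ _ _,
      where w = "exp ((lam - mu) * l) * exp (lam * lx x)"
        and w' = "exp ((lam - mu) * l') * exp (lam * lx x)" and s = "q * \<alpha>1 / \<alpha>2"])
  show "nonresonant b b' (q / x) (q / \<alpha>2) (x / E) (1 / \<alpha>1)"
    using nr by (auto simp: nonresonant_def mult.commute)
qed (unfold th ys J41.simps J43.simps exp_shifts exp_mu, insert assms[unfolded exp_shifts] conv,
  use nz q_nz b in \<open>simp_all add: nphi_commute power2_eq_square mult_ac\<close>)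

lemma relation_J5:
  assumes "theta q (b * x / q) \<noteq> 0" "theta q (exp ((- lam) * lq) * \<alpha>1 * x) \<noteq> 0"
    "theta q (\<alpha>2 / b) \<noteq> 0" "theta q (exp ((- lam) * lq) * b * b' * x / \<alpha>1) \<noteq> 0"
  shows "y_beta1 P x = J51 P x * (y_alpha1 P x - y_lambda P x) + J53 P x * y_x P x"
proof (rule relation_of_connection[OF connection_formula[of b "q / x" "b'" "1 / \<alpha>1" "x / E" "q / \<alpha>2"
        "E * \<alpha>1 * \<alpha>2 / (b * b')"] _ _ _ _ _ _,
      where w = "exp ((lam - mu) * l) * exp (lam * lx x)"
        and w' = "exp ((lam - mu) * lq) * exp (mu * lx x)" and s = "1"])
  show "nonresonant b (q / x) b' (1 / \<alpha>1) (x / E) (q / \<alpha>2)"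
    using nr by (auto simp: nonresonant_def mult.commute)
qed (unfold th ys J51.simps J53.simps exp_shifts exp_mu, insert assms[unfolded exp_shifts] conv,
  use nz q_nz b in \<open>simp_all add: nphi_commute power2_eq_square mult_ac\<close>)

lemma relation_J6:
  assumes "theta q (b / b') \<noteq> 0" "theta q (exp ((- lam) * lq) * \<alpha>1 * x) \<noteq> 0"
    "theta q (\<alpha>2 / b) \<noteq> 0" "theta q (exp (lam * lq) * \<alpha>1 / b) \<noteq> 0"
  shows "y_beta1 P x = J61 P x * (y_alpha1 P x - y_lambda P x) + J63 P x * y_beta2 P x"
proof (rule relation_of_connection[OF connection_formula[of b "b'" "q / x" "1 / \<alpha>1" "x / E" "q / \<alpha>2"
        "E * \<alpha>1 * \<alpha>2 / (b * b')"] _ _ _ _ _ _,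
      where w = "exp ((lam - mu) * l) * exp (lam * lx x)"
        and w' = "exp ((lam - mu) * l') * exp (lam * lx x)" and s = "1"])
  show "nonresonant b b' (q / x) (1 / \<alpha>1) (x / E) (q / \<alpha>2)"
    using nr by (auto simp: nonresonant_def mult.commute)
qed (unfold th ys J61.simps J63.simps exp_shifts exp_mu, insert assms[unfolded exp_shifts] conv,
  use nz q_nz b in \<open>simp_all add: nphi_commute power2_eq_square mult_ac\<close>)

end

context
  assumes mu: "exp (mu * lq) * \<alpha>1 * \<alpha>2 / (b * b') = 1"
    and lxq: "lx (q * x) = lq + lx x"
begin

lemma theta_shift:
  assumes "a \<noteq> 0"
  shows "theta q (a * (q * x)) = - theta q (a * x) / (a * x)"
    and "d \<noteq> 0 \<Longrightarrow> theta q (a * (q * x) / d) = - theta q (a * x / d) / (a * x / d)"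
  using theta_q_mult[of "a * x"] theta_q_mult[of "a * x / d"] assms nz by (simp_all add: mult_ac)

lemma exp_shift: "exp (s * lx (q * x)) = exp (s * lq) * exp (s * lx x)"
  unfolding lxq by (simp add: ring_distribs exp_add)

text \<open>
  The factors that \<open>J13\<close>, \<open>J33\<close> and \<open>J53\<close> acquire under \<open>x \<mapsto> q x\<close> cancel only because of this
  consequence of the relation between \<open>mu\<close> and the other parameters.
\<close>
lemma exp_mu_lq: "exp ((lam - mu) * lq) = E * \<alpha>1 * \<alpha>2 / (b * b')"
proof -
  have "exp (mu * lq) = b * b' / (\<alpha>1 * \<alpha>2)"
    using mu b nz by (simp add: field_simps)
  then show ?thesis
    by (simp add: left_diff_distrib exp_diff)
qed

text \<open>
  These facts discharge the side conditions of \<open>theta_shift\<close> without touching the arguments of the theta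
  functions, which it has to match as they stand.
\<close>
lemmas nonzeros = b nz q_nz exp_not_eq_zero mult_eq_0_iff divide_eq_0_iff one_neq_zero simp_thms

lemma J11_shift: "J11 P (q * x) = J11 P x"
  unfolding J11.simps exp_shifts exp_shift exp_mu_lq
  by (simp only: theta_shift nonzeros, use b nz q_nz in \<open>simp add: divide_simps\<close>)

lemma J13_shift: "J13 P (q * x) = J13 P x"
  unfolding J13.simps exp_shifts exp_shift exp_mu_lq
  by (simp only: theta_shift nonzeros, use b nz q_nz in \<open>simp add: divide_simps\<close>)

lemma J21_shift: "J21 P (q * x) = J21 P x"
  unfolding J21.simps exp_shifts exp_shift exp_mu_lq
  by (simp only: theta_shift nonzeros, use b nz q_nz in \<open>simp add: divide_simps\<close>)

lemma J23_shift: "J23 P (q * x) = J23 P x"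
  unfolding J23.simps exp_shifts exp_shift exp_mu_lq
  by (simp only: theta_shift nonzeros, use b nz q_nz in \<open>simp add: divide_simps\<close>)

lemma J31_shift: "J31 P (q * x) = J31 P x"
  unfolding J31.simps exp_shifts exp_shift exp_mu_lq
  by (simp only: theta_shift nonzeros, use b nz q_nz in \<open>simp add: divide_simps\<close>)

lemma J33_shift: "J33 P (q * x) = J33 P x"
  unfolding J33.simps exp_shifts exp_shift exp_mu_lq
  by (simp only: theta_shift nonzeros, use b nz q_nz in \<open>simp add: divide_simps\<close>)

lemma J41_shift: "J41 P (q * x) = J41 P x"
  unfolding J41.simps exp_shifts exp_shift exp_mu_lq
  by (simp only: theta_shift nonzeros, use b nz q_nz in \<open>simp add: divide_simps\<close>)

lemma J43_shift: "J43 P (q * x) = J43 P x"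
  unfolding J43.simps exp_shifts
  by simp

lemma J51_shift: "J51 P (q * x) = J51 P x"
  unfolding J51.simps exp_shifts exp_shift exp_mu_lq
  by (simp only: theta_shift nonzeros, use b nz q_nz in \<open>simp add: divide_simps\<close>)

lemma J53_shift: "J53 P (q * x) = J53 P x"
  unfolding J53.simps exp_shifts exp_shift exp_mu_lq
  by (simp only: theta_shift nonzeros, use b nz q_nz in \<open>simp add: divide_simps\<close>)

lemma J61_shift: "J61 P (q * x) = J61 P x"
  unfolding J61.simps exp_shifts exp_shift exp_mu_lq
  by (simp only: theta_shift nonzeros, use b nz q_nz in \<open>simp add: divide_simps\<close>)

lemma J63_shift: "J63 P (q * x) = J63 P x"
  unfolding J63.simps exp_shifts
  by simp

end

end

lemma y_swap_beta:
  assumes "b \<noteq> 0" "b' \<noteq> 0"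
  shows "y_alpha1 (P b' b l' l) x = y_alpha1 (P b b' l l') x"
    "y_alpha2 (P b' b l' l) x = y_alpha2 (P b b' l l') x"
    "y_lambda (P b' b l' l) x = y_lambda (P b b' l l') x"
    "y_beta1 (P b' b l' l) x = y_beta2 (P b b' l l') x"
    "y_x (P b' b l' l) x = y_x (P b b' l l') x"
  unfolding y_alpha1_eq[OF assms] y_alpha2_eq[OF assms] y_lambda_eq[OF assms] y_beta2_eq[OF assms]
    y_x_eq[OF assms] y_alpha1_eq[OF assms(2,1)] y_alpha2_eq[OF assms(2,1)] y_lambda_eq[OF assms(2,1)]
    y_beta1_eq[OF assms(2,1)] y_x_eq[OF assms(2,1)]
  by (simp_all add: nphi_commute mult.commute[of b' b])

end

section \<open>The theorem\<close>

theorem theorem4p2: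
  fixes q lq \<alpha>1 \<alpha>2 \<beta>1 \<beta>2 l1 l2 lam mu :: complex
    and lx :: "complex \<Rightarrow> complex"
    and P :: params
  assumes P: "P = Params q lq \<alpha>1 \<alpha>2 \<beta>1 \<beta>2 l1 l2 lam mu lx"
    and q: "0 < norm q" "norm q < 1"
    and nonzero: "\<alpha>1 \<noteq> 0" "\<alpha>2 \<noteq> 0" "\<beta>1 \<noteq> 0" "\<beta>2 \<noteq> 0"
    and logs: "exp lq = q" "exp l1 = \<beta>1" "exp l2 = \<beta>2"
    and log_x: "\<And>x. x \<noteq> 0 \<Longrightarrow> exp (lx x) = x"
    and log_qx: "\<And>x. x \<noteq> 0 \<Longrightarrow> lx (q * x) = lq + lx x"
    and mu: "exp (mu * lq) * \<alpha>1 * \<alpha>2 / (\<beta>1 * \<beta>2) = 1"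
    and conv: "norm (exp (lam * lq) * \<alpha>1 * \<alpha>2 / (\<beta>1 * \<beta>2)) < 1"
  shows "(\<forall>x. x \<noteq> 0 \<longrightarrow> generic P x \<longrightarrow>
            y_beta1 P x = J11 P x * (y_alpha1 P x - y_alpha2 P x) + J13 P x * y_x P x \<and>
            y_beta1 P x = J21 P x * (y_alpha1 P x - y_alpha2 P x) + J23 P x * y_beta2 P x \<and>
            y_beta1 P x = J31 P x * (y_alpha2 P x - y_lambda P x) + J33 P x * y_x P x \<and>
            y_beta1 P x = J41 P x * (y_alpha2 P x - y_lambda P x) + J43 P x * y_beta2 P x \<and>
            y_beta1 P x = J51 P x * (y_alpha1 P x - y_lambda P x) + J53 P x * y_x P x \<and>
            y_beta1 P x = J61 P x * (y_alpha1 P x - y_lambda P x) + J63 P x * y_beta2 P x \<and>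
            y_beta2 P x = K11 P x * (y_alpha1 P x - y_alpha2 P x) + K13 P x * y_x P x \<and>
            y_beta2 P x = K31 P x * (y_alpha2 P x - y_lambda P x) + K33 P x * y_x P x \<and>
            y_beta2 P x = K51 P x * (y_alpha1 P x - y_lambda P x) + K53 P x * y_x P x) \<and>
         (\<forall>S \<in> {J11, J13, J21, J23, J31, J33, J41, J43, J51, J53, J61, J63,
                K11, K13, K31, K33, K51, K53}. pseudo_constant q (S P))"
proof -
  interpret q_disc q
    using q by unfold_locales auto
  have data: "jackson_data q lq \<alpha>1 \<alpha>2 x" if "x \<noteq> 0" for x
    using that nonzero logs by unfold_locales auto
  have relations:
    "y_beta1 P x = J11 P x * (y_alpha1 P x - y_alpha2 P x) + J13 P x * y_x P x"
    "y_beta1 P x = J21 P x * (y_alpha1 P x - y_alpha2 P x) + J23 P x * y_beta2 P x"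
    "y_beta1 P x = J31 P x * (y_alpha2 P x - y_lambda P x) + J33 P x * y_x P x"
    "y_beta1 P x = J41 P x * (y_alpha2 P x - y_lambda P x) + J43 P x * y_beta2 P x"
    "y_beta1 P x = J51 P x * (y_alpha1 P x - y_lambda P x) + J53 P x * y_x P x"
    "y_beta1 P x = J61 P x * (y_alpha1 P x - y_lambda P x) + J63 P x * y_beta2 P x"
    "y_beta2 P x = K11 P x * (y_alpha1 P x - y_alpha2 P x) + K13 P x * y_x P x"
    "y_beta2 P x = K31 P x * (y_alpha2 P x - y_lambda P x) + K33 P x * y_x P x"
    "y_beta2 P x = K51 P x * (y_alpha1 P x - y_lambda P x) + K53 P x * y_x P x"
    if x: "x \<noteq> 0" and gen: "generic P x" for x
  proof -
    interpret jackson_data q lq \<alpha>1 \<alpha>2 lam mu lx x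
      by (rule data[OF x])
    note gen = gen[unfolded P generic.simps]
    have nr: "nonresonant \<beta>1 \<beta>2 (q / x) (1 / \<alpha>1) (q / \<alpha>2) (x / E)"
      using gen[unfolded exp_shifts] nonzero x q_nz unfolding nonresonant_def
      by (simp add: qpoch_inf_singleton qpoch_singleton pinf_nonzero_iff mult_ac power2_eq_square)
    note nr' = nonresonant_commute[OF nr]
    have conv': "norm (E * \<alpha>1 * \<alpha>2 / (\<beta>2 * \<beta>1)) < 1"
      using conv by (simp add: mult.commute)
    note J = nonzero(3,4) nr conv
    note K = nonzero(4,3) nr' conv'
    note swap = y_swap_beta[OF nonzero(3,4)]
    show "y_beta1 P x = J11 P x * (y_alpha1 P x - y_alpha2 P x) + J13 P x * y_x P x"
      unfolding P by (rule relation_J1[OF J]) (use gen in simp_all)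
    show "y_beta1 P x = J21 P x * (y_alpha1 P x - y_alpha2 P x) + J23 P x * y_beta2 P x"
      unfolding P by (rule relation_J2[OF J]) (use gen in simp_all)
    show "y_beta1 P x = J31 P x * (y_alpha2 P x - y_lambda P x) + J33 P x * y_x P x"
      unfolding P by (rule relation_J3[OF J]) (use gen in simp_all)
    show "y_beta1 P x = J41 P x * (y_alpha2 P x - y_lambda P x) + J43 P x * y_beta2 P x"
      unfolding P by (rule relation_J4[OF J]) (use gen in simp_all)
    show "y_beta1 P x = J51 P x * (y_alpha1 P x - y_lambda P x) + J53 P x * y_x P x"
      unfolding P by (rule relation_J5[OF J]) (use gen in simp_all)
    show "y_beta1 P x = J61 P x * (y_alpha1 P x - y_lambda P x) + J63 P x * y_beta2 P x"
      unfolding P by (rule relation_J6[OF J]) (use gen in simp_all)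
    show "y_beta2 P x = K11 P x * (y_alpha1 P x - y_alpha2 P x) + K13 P x * y_x P x"
      unfolding P K11_def K13_def swap_beta.simps
      by (rule relation_J1[OF K, where l = l2 and l' = l1, unfolded swap]) (use gen in \<open>simp_all add: mult_ac\<close>)
    show "y_beta2 P x = K31 P x * (y_alpha2 P x - y_lambda P x) + K33 P x * y_x P x"
      unfolding P K31_def K33_def swap_beta.simps
      by (rule relation_J3[OF K, where l = l2 and l' = l1, unfolded swap]) (use gen in \<open>simp_all add: mult_ac\<close>)
    show "y_beta2 P x = K51 P x * (y_alpha1 P x - y_lambda P x) + K53 P x * y_x P x"
      unfolding P K51_def K53_def swap_beta.simps
      by (rule relation_J5[OF K, where l = l2 and l' = l1, unfolded swap]) (use gen in \<open>simp_all add: mult_ac\<close>)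
  qed
  have mu': "exp (mu * lq) * \<alpha>1 * \<alpha>2 / (\<beta>2 * \<beta>1) = 1"
    using mu by (simp add: mult.commute)
  have pseudo: "\<forall>S \<in> {J11, J13, J21, J23, J31, J33, J41, J43, J51, J53, J61, J63}. S Q (q * x) = S Q x"
    if "Q \<in> {P, swap_beta P}" "x \<noteq> 0" for Q x
  proof -
    interpret jackson_data q lq \<alpha>1 \<alpha>2 lam mu lx x
      by (rule data[OF that(2)])
    note J = nonzero(3,4) mu log_qx[OF that(2)]
    note K = nonzero(4,3) mu' log_qx[OF that(2)]
    note shifts = J11_shift J13_shift J21_shift J23_shift J31_shift J33_shift
      J41_shift J43_shift J51_shift J53_shift J61_shift J63_shift
    show ?thesis
      using that(1) unfolding P swap_beta.simps
      by (elim insertE emptyE; hypsubst; simp only: ball_simps shifts[OF J] shifts[OF K] simp_thms)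
  qed
  show ?thesis
    using relations pseudo
    by (simp add: pseudo_constant_def K11_def K13_def K31_def K33_def K51_def K53_def)
qed

end
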